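(* Let $W_1(z),W_2(z)$ be the currents defined in the context. Then $$W_i(z)W_i(w)+W_i(w)W_i(z)=qz^{-1}\delta\Big(\frac{q_2w}{z}\Big)+q^{-1}z^{-1}\delta\Big(\frac{w}{q_2z}\Big)\qquad(i=1,2),$$ $$f\Big(\frac wz\Big)zW_i(z)W_j(w)-f\Big(\frac zw\Big)wW_j(w)W_i(z)=0\qquad(i\neq j),$$ where $$f(z)=\exp\Big(-\sum_{n>0}\frac{q_1^n+q_3^n}{n(1+q_2^{-n})}z^n\Big).$$
   Context: Parameters: $q,d\in\mathbb C$ with $q^nd^m\ne1$ for all integers $(n,m)\neq(0,0)$; $q_1=q^{-1}d$, $q_2=q^2$, $q_3=q^{-1}d^{-1}$ (so $q_1q_2q_3=1$); $\beta=-\log q_3/\log q_1$, so $q_3=q_1^{-\beta}$. Formal delta function: $\delta(z)=\sum_{n\in\mathbb Z}z^n$. Heisenberg algebra: generators $h^\perp_{i,n},Q_i^\perp$ ($i=1,2$, $n\in\mathbb Z$), $\mathsf a_0^\perp,\mathsf Q^\perp$ with $[h^\perp_{i,n},h^\perp_{i,m}]=n\delta_{n+m,0}$; $[h^\perp_{i,n},h^\perp_{j,m}]=-n\frac{q_1^n+q_3^n}{1+q_2^{-n}}\delta_{n+m,0}$ for $i\ne j$; $[h^\perp_{i,0},Q_i^\perp]=1$, $[h^\perp_{i,0},Q^\perp_j]=-1$ for $i\ne j$; $[\mathsf a_0^\perp,\mathsf Q^\perp]=\beta/2$; $h^\perp_{1,0}=-h^\perp_{2,0}$, $Q_1^\perp=-Q_2^\perp$;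 other commutators vanish. $:\ast:$ is the normal ordering (modes with $n<0$ and $Q_i^\perp,\mathsf Q^\perp$ to the left; modes with $n\ge 0$ and $\mathsf a_0^\perp$ to the right). $W_i(z)=\Lambda_i^+(z)+\Lambda_i^-(z)$ with $$\Lambda_i^+(z)=:\exp\Big(-\sum_{n\ne0}\frac{q^n}{n}h^\perp_{i,n}z^{-n}\Big):e^{Q_i^\perp}(q^{-1}z)^{h^\perp_{i,0}}q_1^{\mathsf a_0^\perp},\qquad \Lambda_i^-(z)=:\exp\Big(\sum_{n\ne0}\frac{q^{-n}}{n}h^\perp_{i,n}z^{-n}\Big):e^{-Q_i^\perp}(qz)^{-h^\perp_{i,0}}q_1^{-\mathsf a_0^\perp}.$$ Identities are between formal series in $z,w$; structure functions of $w/z$ (resp. $z/w$) are power series in $w/z$ (resp. $z/w$). *)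

theory Defs
  imports
    Complex_Main
    "HOL-Library.Groups_Big_Fun"
    "HOL-Computational_Algebra.Formal_Power_Series"
begin

section \<open>Parameters and structure functions\<close>

definition q1 :: "complex \<Rightarrow> complex \<Rightarrow> complex" where
  "q1 q d = inverse q * d"

definition q2 :: "complex \<Rightarrow> complex" where
  "q2 q = q\<^sup>2"

definition q3 :: "complex \<Rightarrow> complex \<Rightarrow> complex" where
  "q3 q d = inverse q * inverse d"

definition struct_coeff :: "complex \<Rightarrow> complex \<Rightarrow> int \<Rightarrow> complex" where
  "struct_coeff q d n = (q1 q d powi n + q3 q d powi n) / (1 + q2 q powi (- n))"

definition struct_fun :: "complex \<Rightarrow> complex \<Rightarrow> complex fps" where
  "struct_fun q d = fps_compose (fps_exp 1)
     (Abs_fps (\<lambda>n. if n = 0 then 0 else - (struct_coeff q d (int n) / of_nat n)))"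

section \<open>Formal series\<close>

text \<open>
  A formal series in \<open>z\<close> with operator coefficients is a function \<open>A\<close> on \<open>int\<close>; \<open>A n\<close> is
  the coefficient of \<open>z\<close> to the power \<open>+n\<close> (not the mode \<open>-n\<close>). A series in \<open>z, w\<close> is a
  function \<open>F\<close> on pairs; \<open>F m n\<close> is the coefficient of \<open>z\<close> to the \<open>m\<close> times \<open>w\<close> to the \<open>n\<close>.

  Infinite sums of vectors are taken with \<open>Sum_any\<close>, which is the sum over the support when
  that is finite (and junk otherwise). That all supports met in the currents and in the
  relations are finite is shown at the end of this theory.
\<close>

definition ser_mult ::
  "(int \<Rightarrow> 'v \<Rightarrow> 'v) \<Rightarrow> (int \<Rightarrow> 'v \<Rightarrow> 'v) \<Rightarrow> int \<Rightarrow> 'v \<Rightarrow> 'v::ab_group_add" where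
  "ser_mult A B n v = (\<Sum>k. A (n - k) (B k v))"

text \<open>\<open>ser_pow a k\<close> is the \<open>k\<close>-th power of \<open>a 1 x + a 2 x\<^sup>2 + a 3 x\<^sup>3 + \<dots>\<close>; as there is no
  constant term, the coefficient of \<open>x\<close> to the \<open>n\<close> in its exponential only involves \<open>k \<le> n\<close>.\<close>

primrec ser_pow :: "(nat \<Rightarrow> 'v \<Rightarrow> 'v) \<Rightarrow> nat \<Rightarrow> nat \<Rightarrow> 'v \<Rightarrow> 'v::ab_group_add" where
  "ser_pow a 0 n v = (if n = 0 then v else 0)"
| "ser_pow a (Suc k) n v = (\<Sum>m=1..n. a m (ser_pow a k (n - m) v))"

definition ser_exp ::
  "(complex \<Rightarrow> 'v \<Rightarrow> 'v) \<Rightarrow> (nat \<Rightarrow> 'v \<Rightarrow> 'v) \<Rightarrow> nat \<Rightarrow> 'v \<Rightarrow> 'v::ab_group_add" where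
  "ser_exp scale a n v = (\<Sum>k\<le>n. scale (1 / fact k) (ser_pow a k n v))"

text \<open>\<open>:exp (\<Sum>\<^bsub>n \<noteq> 0\<^esub> c n X n z\<^bsup>-n\<^esup>):\<close> for modes \<open>X n\<close>, the modes with \<open>n < 0\<close> to the left.\<close>

definition normal_exp ::
  "(complex \<Rightarrow> 'v \<Rightarrow> 'v) \<Rightarrow> (int \<Rightarrow> complex) \<Rightarrow> (int \<Rightarrow> 'v \<Rightarrow> 'v) \<Rightarrow> int \<Rightarrow> 'v \<Rightarrow> 'v::ab_group_add" where
  "normal_exp scale c X = ser_mult
     (\<lambda>k v. if k \<ge> 0 then ser_exp scale (\<lambda>n v. scale (c (- int n)) (X (- int n) v)) (nat k) v else 0)
     (\<lambda>k v. if k \<le> 0 then ser_exp scale (\<lambda>n v. scale (c (int n)) (X (int n) v)) (nat (- k)) v else 0)"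

text \<open>\<open>\<phi>(T)\<close> for a diagonalizable linear operator \<open>T\<close>.\<close>

definition op_fun ::
  "(complex \<Rightarrow> 'v \<Rightarrow> 'v) \<Rightarrow> (complex \<Rightarrow> complex) \<Rightarrow> ('v \<Rightarrow> 'v) \<Rightarrow> 'v \<Rightarrow> 'v::ab_group_add" where
  "op_fun scale \<phi> T = (THE F. Vector_Spaces.linear scale scale F \<and>
     (\<forall>x v. T v = scale x v \<longrightarrow> F v = scale (\<phi> x) v))"

text \<open>The formal series \<open>(c z)\<^bsup>T\<^esup>\<close> for a diagonalizable \<open>T\<close> with integer eigenvalues: on the
  \<open>n\<close>-eigenspace it is multiplication by \<open>c\<^bsup>n\<^esup> z\<^bsup>n\<^esup>\<close>.\<close>

definition z_powr ::
  "(complex \<Rightarrow> 'v \<Rightarrow> 'v) \<Rightarrow> complex \<Rightarrow> ('v \<Rightarrow> 'v) \<Rightarrow> int \<Rightarrow> 'v \<Rightarrow> 'v::ab_group_add" where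
  "z_powr scale c T n = op_fun scale (\<lambda>x. if x = of_int n then c powi n else 0) T"

definition prod_zw ::  \<comment> \<open>\<open>A(z) B(w)\<close>\<close>
  "(int \<Rightarrow> 'v \<Rightarrow> 'v) \<Rightarrow> (int \<Rightarrow> 'v \<Rightarrow> 'v) \<Rightarrow> int \<Rightarrow> int \<Rightarrow> 'v \<Rightarrow> 'v" where
  "prod_zw A B m n v = A m (B n v)"

definition prod_wz ::  \<comment> \<open>\<open>B(w) A(z)\<close>\<close>
  "(int \<Rightarrow> 'v \<Rightarrow> 'v) \<Rightarrow> (int \<Rightarrow> 'v \<Rightarrow> 'v) \<Rightarrow> int \<Rightarrow> int \<Rightarrow> 'v \<Rightarrow> 'v" where
  "prod_wz B A m n v = B n (A m v)"

definition mult_z_power :: "int \<Rightarrow> (int \<Rightarrow> int \<Rightarrow> 'b) \<Rightarrow> int \<Rightarrow> int \<Rightarrow> 'b" where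
  "mult_z_power a F m n = F (m - a) n"

definition mult_w_power :: "int \<Rightarrow> (int \<Rightarrow> int \<Rightarrow> 'b) \<Rightarrow> int \<Rightarrow> int \<Rightarrow> 'b" where
  "mult_w_power a F m n = F m (n - a)"

definition delta_wz :: "complex \<Rightarrow> int \<Rightarrow> int \<Rightarrow> complex" where  \<comment> \<open>\<open>\<delta>(c w / z)\<close>\<close>
  "delta_wz c m n = (if m = - n then c powi n else 0)"

definition mult_fps_wz ::  \<comment> \<open>\<open>f(w / z) F(z, w)\<close>\<close>
  "(complex \<Rightarrow> 'v \<Rightarrow> 'v) \<Rightarrow> complex fps \<Rightarrow> (int \<Rightarrow> int \<Rightarrow> 'v \<Rightarrow> 'v) \<Rightarrow> int \<Rightarrow> int \<Rightarrow> 'v \<Rightarrow> 'v::ab_group_add" where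
  "mult_fps_wz scale f F m n v = (\<Sum>k. scale (fps_nth f k) (F (m + int k) (n - int k) v))"

definition mult_fps_zw ::  \<comment> \<open>\<open>f(z / w) F(z, w)\<close>\<close>
  "(complex \<Rightarrow> 'v \<Rightarrow> 'v) \<Rightarrow> complex fps \<Rightarrow> (int \<Rightarrow> int \<Rightarrow> 'v \<Rightarrow> 'v) \<Rightarrow> int \<Rightarrow> int \<Rightarrow> 'v \<Rightarrow> 'v::ab_group_add" where
  "mult_fps_zw scale f F m n v = (\<Sum>k. scale (fps_nth f k) (F (m - int k) (n + int k) v))"

section \<open>Representations of the Heisenberg algebra\<close>

text \<open>
  A module over the Heisenberg algebra on which the currents make sense. The arguments \<open>h i n\<close>
  (\<open>i = 1, 2\<close>) and \<open>a0\<close> stand for \<open>h\<^sup>\<bottom>\<^bsub>i,n\<^esub>\<close> and \<open>a\<^sup>\<bottom>\<^bsub>0\<^esub>\<close>.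

  As usual for Fock modules, the generators \<open>Q\<^bsub>i\<^esub>\<close> and \<open>Q\<close> act only through their exponentials
  \<open>eQ i\<close> and \<open>eQ0\<close> (an operator \<open>Q\<close> with \<open>[X, Q]\<close> a nonzero scalar cannot act on a space on
  which \<open>X\<close> is diagonalizable). A relation \<open>[X, Q] = c\<close> thus reads \<open>X e\<^bsup>Q\<^esup> = e\<^bsup>Q\<^esup> (X + c)\<close>, and
  \<open>Q\<^bsub>1\<^esub> = - Q\<^bsub>2\<^esub>\<close> says that \<open>eQ 1\<close> and \<open>eQ 2\<close> are mutually inverse.

  The last three assumptions express that \<open>z\<close> to the power \<open>h\<^bsub>i,0\<^esub>\<close> is a formal series in
  integer powers of \<open>z\<close>, that \<open>q\<^bsub>1\<^esub>\<close> to the power \<open>a\<^bsub>0\<^esub>\<close> makes sense, and that each vector is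
  killed by all products of annihilation modes of large total degree.
\<close>

locale heisenberg_module = vector_space scale
  for scale :: "complex \<Rightarrow> 'v \<Rightarrow> 'v::ab_group_add" +
  fixes q d \<beta> :: complex
    and h :: "nat \<Rightarrow> int \<Rightarrow> 'v \<Rightarrow> 'v"
    and a0 :: "'v \<Rightarrow> 'v"
    and eQ :: "nat \<Rightarrow> 'v \<Rightarrow> 'v"
    and eQ0 :: "'v \<Rightarrow> 'v"
  assumes linear_h: "i \<in> {1, 2} \<Longrightarrow> Vector_Spaces.linear scale scale (h i n)"
    and linear_a0: "Vector_Spaces.linear scale scale a0"
    and linear_eQ: "i \<in> {1, 2} \<Longrightarrow> Vector_Spaces.linear scale scale (eQ i)"
    and linear_eQ0: "Vector_Spaces.linear scale scale eQ0"
    and bij_eQ: "i \<in> {1, 2} \<Longrightarrow> bij (eQ i)"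
    and bij_eQ0: "bij eQ0"
    and h_h_same: "i \<in> {1, 2} \<Longrightarrow>
      h i n (h i m v) - h i m (h i n v) = scale (if n + m = 0 then of_int n else 0) v"
    and h_h_diff: "i \<in> {1, 2} \<Longrightarrow> j \<in> {1, 2} \<Longrightarrow> i \<noteq> j \<Longrightarrow>
      h i n (h j m v) - h j m (h i n v)
        = scale (if n + m = 0 then - of_int n * struct_coeff q d n else 0) v"
    and h_a0: "i \<in> {1, 2} \<Longrightarrow> h i n (a0 v) = a0 (h i n v)"
    and h0_eQ_same: "i \<in> {1, 2} \<Longrightarrow> h i 0 (eQ i v) = eQ i (h i 0 v + v)"
    and h0_eQ_diff: "i \<in> {1, 2} \<Longrightarrow> j \<in> {1, 2} \<Longrightarrow> i \<noteq> j \<Longrightarrow> h i 0 (eQ j v) = eQ j (h i 0 v - v)"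
    and h_eQ: "i \<in> {1, 2} \<Longrightarrow> j \<in> {1, 2} \<Longrightarrow> n \<noteq> 0 \<Longrightarrow> h i n (eQ j v) = eQ j (h i n v)"
    and a0_eQ: "i \<in> {1, 2} \<Longrightarrow> a0 (eQ i v) = eQ i (a0 v)"
    and a0_eQ0: "a0 (eQ0 v) = eQ0 (a0 v + scale (\<beta> / 2) v)"
    and h_eQ0: "i \<in> {1, 2} \<Longrightarrow> h i n (eQ0 v) = eQ0 (h i n v)"
    and eQ_eQ0: "i \<in> {1, 2} \<Longrightarrow> eQ i (eQ0 v) = eQ0 (eQ i v)"
    and h_1_2: "h 1 0 v = - h 2 0 v"
    and eQ_1_2: "eQ 1 (eQ 2 v) = v"
    and diag_h0: "span {v. \<exists>n::int. h 1 0 v = scale (of_int n) v} = UNIV"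
    and diag_a0: "span {v. \<exists>x. a0 v = scale x v} = UNIV"
    and smooth: "\<exists>N::int. \<forall>ws. (\<forall>(i, n) \<in> set ws. i \<in> {1, 2} \<and> n > 0) \<and>
      sum_list (map snd ws) > N \<longrightarrow> foldr (\<lambda>(i, n). h i n) ws v = 0"

section \<open>The currents\<close>

text \<open>\<open>l1\<close> is the chosen value of \<open>log q\<^bsub>1\<^esub>\<close>, so \<open>q\<^bsub>1\<^esub>\<close> to the power \<open>a\<^bsub>0\<^esub>\<close> is \<open>exp (l1 a\<^bsub>0\<^esub>)\<close>.\<close>

definition Lambda_plus ::
  "(complex \<Rightarrow> 'v \<Rightarrow> 'v) \<Rightarrow> complex \<Rightarrow> complex \<Rightarrow> (nat \<Rightarrow> int \<Rightarrow> 'v \<Rightarrow> 'v) \<Rightarrow> ('v \<Rightarrow> 'v) \<Rightarrow>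
   (nat \<Rightarrow> 'v \<Rightarrow> 'v) \<Rightarrow> nat \<Rightarrow> int \<Rightarrow> 'v \<Rightarrow> 'v::ab_group_add" where
  "Lambda_plus scale q l1 h a0 eQ i = ser_mult
     (normal_exp scale (\<lambda>n. - (q powi n / of_int n)) (h i))
     (\<lambda>k v. eQ i (z_powr scale (inverse q) (h i 0) k (op_fun scale (\<lambda>x. exp (l1 * x)) a0 v)))"

definition Lambda_minus ::
  "(complex \<Rightarrow> 'v \<Rightarrow> 'v) \<Rightarrow> complex \<Rightarrow> complex \<Rightarrow> (nat \<Rightarrow> int \<Rightarrow> 'v \<Rightarrow> 'v) \<Rightarrow> ('v \<Rightarrow> 'v) \<Rightarrow>
   (nat \<Rightarrow> 'v \<Rightarrow> 'v) \<Rightarrow> nat \<Rightarrow> int \<Rightarrow> 'v \<Rightarrow> 'v::ab_group_add" where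
  "Lambda_minus scale q l1 h a0 eQ i = ser_mult
     (normal_exp scale (\<lambda>n. q powi (- n) / of_int n) (h i))
     (\<lambda>k v. inv (eQ i) (z_powr scale q (\<lambda>v. - h i 0 v) k (op_fun scale (\<lambda>x. exp (- l1 * x)) a0 v)))"

definition W_current ::
  "(complex \<Rightarrow> 'v \<Rightarrow> 'v) \<Rightarrow> complex \<Rightarrow> complex \<Rightarrow> (nat \<Rightarrow> int \<Rightarrow> 'v \<Rightarrow> 'v) \<Rightarrow> ('v \<Rightarrow> 'v) \<Rightarrow>
   (nat \<Rightarrow> 'v \<Rightarrow> 'v) \<Rightarrow> nat \<Rightarrow> int \<Rightarrow> 'v \<Rightarrow> 'v::ab_group_add" where
  "W_current scale q l1 h a0 eQ i n v =
     Lambda_plus scale q l1 h a0 eQ i n v + Lambda_minus scale q l1 h a0 eQ i n v"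

section \<open>The definitions are meaningful\<close>

context heisenberg_module
begin

lemma op_fun_ex1:
  assumes T: "Vector_Spaces.linear scale scale T"
    and diag: "span {v. \<exists>x. T v = scale x v} = UNIV"
  shows "\<exists>!F. Vector_Spaces.linear scale scale F \<and> (\<forall>x v. T v = scale x v \<longrightarrow> F v = scale (\<phi> x) v)"
proof -
  interpret P: vector_space_pair scale scale ..
  interpret T: Vector_Spaces.linear scale scale T by fact
  let ?E = "{v. \<exists>x. T v = scale x v}"
  obtain B where B: "B \<subseteq> ?E" "independent B" "?E \<subseteq> span B"
    by (rule maximal_independent_subset[of ?E])
  have span_B: "span B = UNIV"
    using span_minimal[OF B(3) subspace_span] diag by (simp only: top.extremum_unique)
  have "\<forall>b\<in>B. \<exists>x. T b = scale x b" using B(1) by blast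
  then obtain l where l: "T b = scale (l b) b" if "b \<in> B" for b
    unfolding bchoice_iff by blast
  define F where "F = P.construct B (\<lambda>b. scale (\<phi> (l b)) b)"
  have linF: "Vector_Spaces.linear scale scale F"
    unfolding F_def by (rule P.linear_construct) fact
  interpret F: Vector_Spaces.linear scale scale F by fact
  have FB: "F b = scale (\<phi> (l b)) b" if "b \<in> B" for b
    unfolding F_def using P.construct_basis[OF B(2) that] .
  have ev: "F v = scale (\<phi> x) v" if v: "T v = scale x v" for x v
  proof -
    let ?r = "representation B v" and ?S = "{b. representation B v b \<noteq> 0}"
    have fin: "finite ?S" by (rule finite_representation)
    have SB: "?S \<subseteq> B" by (auto intro: representation_ne_zero)
    have v_eq: "v = (\<Sum>b\<in>?S. scale (?r b) b)"
      using sum_nonzero_representation_eq[OF B(2), of v] span_B by simp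
    have "T v = (\<Sum>b\<in>?S. scale (?r b) (scale (l b) b))"
      by (subst v_eq) (auto simp: T.sum T.scale l intro!: sum.cong dest!: subsetD[OF SB])
    moreover have "scale x v = (\<Sum>b\<in>?S. scale (?r b) (scale x b))"
      by (subst v_eq) (simp add: scale_sum_right mult.commute)
    ultimately have "(\<Sum>b\<in>?S. scale (?r b * (l b - x)) b) = 0"
      using v by (simp add: sum_subtractf scale_right_diff_distrib scale_left_diff_distrib right_diff_distrib)
    hence "?r b * (l b - x) = 0" if "b \<in> ?S" for b
      using independentD[OF B(2) fin SB, of "\<lambda>b. ?r b * (l b - x)" b] that by blast
    hence lx: "l b = x" if "b \<in> ?S" for b using that by auto
    have "F v = (\<Sum>b\<in>?S. scale (?r b) (scale (\<phi> (l b)) b))"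
      by (subst v_eq) (auto simp: F.sum F.scale FB intro!: sum.cong dest!: subsetD[OF SB])
    also have "\<dots> = (\<Sum>b\<in>?S. scale (\<phi> x) (scale (?r b) b))"
      using lx by (auto intro!: sum.cong simp: mult.commute)
    also have "\<dots> = scale (\<phi> x) v"
      by (subst (2) v_eq) (simp add: scale_sum_right)
    finally show ?thesis .
  qed
  show ?thesis
  proof (rule ex1I[of _ F])
    show "Vector_Spaces.linear scale scale F \<and> (\<forall>x v. T v = scale x v \<longrightarrow> F v = scale (\<phi> x) v)"
      using linF ev by blast
  next
    fix G assume G: "Vector_Spaces.linear scale scale G \<and> (\<forall>x v. T v = scale x v \<longrightarrow> G v = scale (\<phi> x) v)"
    show "G = F"
    proof
      fix v
      have "v \<in> span B" by (simp add: span_B)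
      moreover have "G b = F b" if "b \<in> B" for b using G FB l that by simp
      ultimately show "G v = F v" using P.linear_eq_on[of G F v B] G linF by blast
    qed
  qed
qed

lemma op_fun:
  assumes "Vector_Spaces.linear scale scale T" "span {v. \<exists>x. T v = scale x v} = UNIV"
  shows linear_op_fun: "Vector_Spaces.linear scale scale (op_fun scale \<phi> T)"
    and op_fun_eigenvector: "T v = scale x v \<Longrightarrow> op_fun scale \<phi> T v = scale (\<phi> x) v"
  using theI'[OF op_fun_ex1[OF assms, of \<phi>]] unfolding op_fun_def by blast+

lemma z_powr:
  assumes T: "Vector_Spaces.linear scale scale T"
    and diag: "span {v. \<exists>n::int. T v = scale (of_int n) v} = UNIV"
  shows linear_z_powr: "Vector_Spaces.linear scale scale (z_powr scale c T k)"
    and z_powr_eigenvector: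
      "T v = scale (of_int n) v \<Longrightarrow> z_powr scale c T k v = (if k = n then scale (c powi n) v else 0)"
    and finite_z_powr: "finite {k. z_powr scale c T k v \<noteq> 0}"
proof -
  have "{v. \<exists>n::int. T v = scale (of_int n) v} \<subseteq> {v. \<exists>x. T v = scale x v}" by auto
  from span_mono[OF this] have d: "span {v. \<exists>x. T v = scale x v} = UNIV" using diag by auto
  show lin: "Vector_Spaces.linear scale scale (z_powr scale c T k)" for k
    unfolding z_powr_def by (rule linear_op_fun[OF T d])
  show eig: "z_powr scale c T k v = (if k = n then scale (c powi n) v else 0)"
    if "T v = scale (of_int n) v" for k v n
    unfolding z_powr_def using op_fun_eigenvector[OF T d that] by auto
  have "v \<in> span {v. \<exists>n::int. T v = scale (of_int n) v}" using diag by simp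
  thus "finite {k. z_powr scale c T k v \<noteq> 0}"
  proof (induction rule: span_induct_alt)
    case base
    have "z_powr scale c T k 0 = 0" for k
      using lin[of k] by (simp add: module_hom.zero[OF Vector_Spaces.linear.axioms(3)])
    thus ?case by simp
  next
    case (step a x y)
    then obtain n where n: "T x = scale (of_int n) x" by auto
    have "z_powr scale c T k (scale a x + y)
        = scale a (z_powr scale c T k x) + z_powr scale c T k y" for k
      using Vector_Spaces.linear.axioms(3)[OF lin[of k]] by (simp add: module_hom.add module_hom.scale)
    hence "{k. z_powr scale c T k (scale a x + y) \<noteq> 0} \<subseteq> insert n {k. z_powr scale c T k y \<noteq> 0}"
      using eig[OF n] by auto
    thus ?case using step by (meson finite.insertI finite_subset)
  qed
qed

lemma h_0: "i \<in> {1, 2} \<Longrightarrow> h i n 0 = 0"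
  by (rule module_hom.zero[OF Vector_Spaces.linear.axioms(3)[OF linear_h]])

lemma h_sum: "i \<in> {1, 2} \<Longrightarrow> h i n (sum f S) = (\<Sum>x\<in>S. h i n (f x))"
  by (rule module_hom.sum[OF Vector_Spaces.linear.axioms(3)[OF linear_h]])

lemma h_scale: "i \<in> {1, 2} \<Longrightarrow> h i n (scale c v) = scale c (h i n v)"
  by (rule module_hom.scale[OF Vector_Spaces.linear.axioms(3)[OF linear_h]])

lemma linear_minus_h:
  assumes "i \<in> {1, 2}"
  shows "Vector_Spaces.linear scale scale (\<lambda>v. - h i n v)"
proof -
  interpret P: vector_space_pair scale scale ..
  show ?thesis by (rule P.linear_compose_neg[OF linear_h[OF assms]])
qed

lemma foldr_h_0: "(\<forall>(i, n) \<in> set ws. i \<in> {1, 2} \<and> n > 0) \<Longrightarrow> foldr (\<lambda>(i, n). h i n) ws 0 = 0"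
  by (induction ws) (auto simp: h_0)

lemma foldr_h_sum_scale:
  "(\<forall>(i, n) \<in> set ws. i \<in> {1, 2} \<and> n > 0) \<Longrightarrow>
   foldr (\<lambda>(i, n). h i n) ws (\<Sum>x\<in>S. scale (c x) (f x))
     = (\<Sum>x\<in>S. scale (c x) (foldr (\<lambda>(i, n). h i n) ws (f x)))"
  by (induction ws) (auto simp: h_sum h_scale)

lemma foldr_ser_pow:
  fixes N :: int
  assumes i: "i \<in> {1, 2}"
    and N: "\<And>ws. (\<forall>(i, n) \<in> set ws. i \<in> {1, 2} \<and> n > 0) \<Longrightarrow> sum_list (map snd ws) > N \<Longrightarrow>
      foldr (\<lambda>(i, n). h i n) ws v = 0"
  shows "(\<forall>(i, n) \<in> set ws. i \<in> {1, 2} \<and> n > 0) \<Longrightarrow> sum_list (map snd ws) + int n > N \<Longrightarrow>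
    foldr (\<lambda>(i, n). h i n) ws (ser_pow (\<lambda>n v. scale (c n) (h i (int n) v)) k n v) = 0"
proof (induction k arbitrary: n ws)
  case 0
  thus ?case by (auto simp: N foldr_h_0)
next
  case (Suc k)
  let ?p = "ser_pow (\<lambda>n v. scale (c n) (h i (int n) v)) k"
  have "foldr (\<lambda>(i, n). h i n) ws (h i (int m) (?p (n - m) v)) = 0" if "m \<in> {1..n}" for m
    using Suc.IH[of "ws @ [(i, int m)]" "n - m"] Suc.prems i that by (auto simp: of_nat_diff)
  thus ?case using Suc.prems by (simp add: foldr_h_sum_scale del: set_simps)
qed

lemma ser_exp_annihilation:
  assumes "i \<in> {1, 2}"
  shows "\<exists>N. \<forall>n > N. ser_exp scale (\<lambda>n v. scale (c n) (h i (int n) v)) n v = 0"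
proof -
  obtain N :: int where N: "\<And>ws. (\<forall>(i, n) \<in> set ws. i \<in> {1, 2} \<and> n > 0) \<Longrightarrow>
      sum_list (map snd ws) > N \<Longrightarrow> foldr (\<lambda>(i, n). h i n) ws v = 0"
    using smooth[of v] by blast
  have "ser_exp scale (\<lambda>n v. scale (c n) (h i (int n) v)) n v = 0" if "n > nat N" for n
    unfolding ser_exp_def
    using foldr_ser_pow[OF assms N, where ws = "[]" and n = n] that by (intro sum.neutral) auto
  thus ?thesis by blast
qed

lemma ser_pow_h_0: "i \<in> {1, 2} \<Longrightarrow> ser_pow (\<lambda>n v. scale (c n) (h i (g n) v)) k n 0 = 0"
  by (induction k arbitrary: n) (auto simp: h_0)

lemma ser_exp_h_0: "i \<in> {1, 2} \<Longrightarrow> ser_exp scale (\<lambda>n v. scale (c n) (h i (g n) v)) n 0 = 0"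
  by (simp add: ser_exp_def ser_pow_h_0)

text \<open>The sums over \<open>k\<close> in \<open>normal_exp\<close> are finite, and \<open>normal_exp\<close> is bounded below.\<close>

lemma normal_exp_finite:
  assumes i: "i \<in> {1, 2}"
  defines "P \<equiv> \<lambda>c k v. if k \<ge> 0 then ser_exp scale (\<lambda>n v. scale (c (- int n)) (h i (- int n) v)) (nat k) v else 0"
    and "M \<equiv> \<lambda>c k v. if k \<le> 0 then ser_exp scale (\<lambda>n v. scale (c (int n)) (h i (int n) v)) (nat (- k)) v else 0"
  shows "finite {k. P c (n - k) (M c k v) \<noteq> 0}"
    and "\<exists>N. \<forall>n < N. normal_exp scale c (h i) n v = 0"
proof -
  obtain N where N: "\<And>n. n > N \<Longrightarrow> ser_exp scale (\<lambda>n v. scale (c (int n)) (h i (int n) v)) n v = 0"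
    using ser_exp_annihilation[OF i, of "\<lambda>n. c (int n)" v] by blast
  have "P c k 0 = 0" for k using ser_exp_h_0[OF i] by (simp add: P_def)
  moreover have "M c k v = 0" if "k < - int N" for k using that N[of "nat (- k)"] by (simp add: M_def)
  moreover have "P c (n - k) v = 0" if "k > n" for n k v using that by (simp add: P_def)
  ultimately have *: "P c (n - k) (M c k v) = 0" if "\<not> (- int N \<le> k \<and> k \<le> n)" for n k
    using that by (metis not_le)
  show "finite {k. P c (n - k) (M c k v) \<noteq> 0}"
    by (rule finite_subset[of _ "{- int N..n}"])
      (simp_all add: subset_iff, metis *)
  have "normal_exp scale c (h i) n v = 0" if "n < - int N" for n
  proof -
    have "P c (n - k) (M c k v) = 0" for k using *[of k n] that by auto
    thus ?thesis unfolding normal_exp_def ser_mult_def P_def M_def by simp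
  qed
  thus "\<exists>N. \<forall>n < N. normal_exp scale c (h i) n v = 0" by blast
qed

lemma normal_exp_0: "i \<in> {1, 2} \<Longrightarrow> normal_exp scale c (h i) n 0 = 0"
  by (simp add: normal_exp_def ser_mult_def ser_exp_h_0 cong: if_cong)

text \<open>Any factor \<open>Z\<close> that only has finitely many terms on each vector can be multiplied from the left
  with \<open>normal_exp\<close>, and the result is bounded below.\<close>

lemma ser_mult_normal_exp:
  assumes i: "i \<in> {1, 2}" and Z: "finite {k. Z k v \<noteq> 0}"
  shows "finite {k. normal_exp scale c (h i) (n - k) (Z k v) \<noteq> 0}"
    and "\<exists>N. \<forall>n < N. ser_mult (normal_exp scale c (h i)) Z n v = 0"
proof -
  show "finite {k. normal_exp scale c (h i) (n - k) (Z k v) \<noteq> 0}"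
    by (rule finite_subset[OF _ Z]) (auto simp: normal_exp_0[OF i])
  have "\<forall>k. \<exists>N. \<forall>n < N. normal_exp scale c (h i) n (Z k v) = 0"
    using normal_exp_finite(2)[OF i] by blast
  then obtain N where N: "\<And>k n. n < N k \<Longrightarrow> normal_exp scale c (h i) n (Z k v) = 0"
    by (auto dest!: choice)
  let ?S = "{k. Z k v \<noteq> 0}"
  define L where "L = (if ?S = {} then 0 else Min ((\<lambda>k. N k + k) ` ?S))"
  have "normal_exp scale c (h i) (n - k) (Z k v) = 0" if "n < L" for n k
  proof (cases "Z k v = 0")
    case False
    hence "L \<le> N k + k" using Z by (auto simp: L_def intro!: Min_le)
    thus ?thesis using N[of "n - k" k] that by auto
  qed (simp add: normal_exp_0[OF i])
  thus "\<exists>N. \<forall>n < N. ser_mult (normal_exp scale c (h i)) Z n v = 0"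
    unfolding ser_mult_def by (intro exI[of _ L]) simp
qed

lemma diag_h0':
  assumes "i \<in> {1, 2}"
  shows "span {v. \<exists>n::int. h i 0 v = scale (of_int n) v} = UNIV"
    and "span {v. \<exists>n::int. - h i 0 v = scale (of_int n) v} = UNIV"
proof -
  have neg: "(\<exists>n::int. - x = scale (of_int n) v) \<longleftrightarrow> (\<exists>n::int. x = scale (of_int n) v)" for x v
    by (metis minus_minus of_int_minus scale_minus_left)
  have "(\<exists>n::int. h i 0 v = scale (of_int n) v) \<longleftrightarrow> (\<exists>n::int. h 1 0 v = scale (of_int n) v)" for v
    using assms neg[of "h 2 0 v" v] by (auto simp only: h_1_2)
  thus "span {v. \<exists>n::int. h i 0 v = scale (of_int n) v} = UNIV"
    "span {v. \<exists>n::int. - h i 0 v = scale (of_int n) v} = UNIV"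
    using diag_h0 neg by simp_all
qed

lemma zero_modes_finite:
  assumes i: "i \<in> {1, 2}"
  shows "finite {k. eQ i (z_powr scale c (h i 0) k v) \<noteq> 0}"
    and "finite {k. inv (eQ i) (z_powr scale c (\<lambda>v. - h i 0 v) k v) \<noteq> 0}"
proof -
  have "eQ i 0 = 0" by (rule module_hom.zero[OF Vector_Spaces.linear.axioms(3)[OF linear_eQ[OF i]]])
  moreover from this have "inv (eQ i) 0 = 0" using bij_eQ[OF i] by (metis bij_inv_eq_iff)
  moreover have "Vector_Spaces.linear scale scale (\<lambda>v. - h i 0 v)"
    by (rule linear_minus_h[OF i])
  ultimately show "finite {k. eQ i (z_powr scale c (h i 0) k v) \<noteq> 0}"
      "finite {k. inv (eQ i) (z_powr scale c (\<lambda>v. - h i 0 v) k v) \<noteq> 0}"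
    by (auto intro: finite_subset[OF _ finite_z_powr[OF linear_h[OF i] diag_h0'(1)[OF i], of c v]]
      finite_subset[OF _ finite_z_powr[OF _ diag_h0'(2)[OF i], of c v]])
qed

lemma W_current_bounded_below:
  assumes "i \<in> {1, 2}"
  shows "\<exists>N. \<forall>n < N. W_current scale q l1 h a0 eQ i n v = 0"
proof -
  have "\<exists>N. \<forall>n < N. Lambda_plus scale q l1 h a0 eQ i n v = 0"
    unfolding Lambda_plus_def by (rule ser_mult_normal_exp(2)[OF assms], rule zero_modes_finite(1)[OF assms])
  then obtain N1 where N1: "\<forall>n < N1. Lambda_plus scale q l1 h a0 eQ i n v = 0" by blast
  have "\<exists>N. \<forall>n < N. Lambda_minus scale q l1 h a0 eQ i n v = 0"
    unfolding Lambda_minus_def by (rule ser_mult_normal_exp(2)[OF assms], rule zero_modes_finite(2)[OF assms])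
  then obtain N2 where N2: "\<forall>n < N2. Lambda_minus scale q l1 h a0 eQ i n v = 0" by blast
  from N1 N2 show ?thesis by (intro exI[of _ "min N1 N2"]) (simp add: W_current_def)
qed

lemma ser_mult_normal_exp_0:
  "i \<in> {1, 2} \<Longrightarrow> (\<And>k. Z k 0 = 0) \<Longrightarrow> ser_mult (normal_exp scale c (h i)) Z n 0 = 0"
  by (simp add: ser_mult_def normal_exp_0)

lemma W_current_0:
  assumes i: "i \<in> {1, 2}"
  shows "W_current scale q l1 h a0 eQ i n 0 = 0"
proof -
  have lin0: "F 0 = 0" if "Vector_Spaces.linear scale scale F" for F
    by (rule module_hom.zero[OF Vector_Spaces.linear.axioms(3)[OF that]])
  have eQ0: "eQ i 0 = 0" using lin0[OF linear_eQ[OF i]] .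
  hence inv0: "inv (eQ i) 0 = 0" using bij_eQ[OF i] by (metis bij_inv_eq_iff)
  have "Vector_Spaces.linear scale scale (\<lambda>v. - h i 0 v)"
    by (rule linear_minus_h[OF i])
  hence "z_powr scale c (h i 0) k 0 = 0" "z_powr scale c (\<lambda>v. - h i 0 v) k 0 = 0" for c k
    using lin0[OF linear_z_powr[OF linear_h[OF i] diag_h0'(1)[OF i]]]
      lin0[OF linear_z_powr[OF _ diag_h0'(2)[OF i]]] by blast+
  thus ?thesis
    unfolding W_current_def Lambda_plus_def Lambda_minus_def
    by (simp add: ser_mult_normal_exp_0[OF i] eQ0 inv0 lin0[OF linear_op_fun[OF linear_a0 diag_a0]])
qed

text \<open>The sums over \<open>k\<close> in the products of \<open>f(w / z)\<close> with \<open>z W\<^bsub>i\<^esub>(z) W\<^bsub>j\<^esub>(w)\<close> and of \<open>f(z / w)\<close> with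
  \<open>w W\<^bsub>j\<^esub>(w) W\<^bsub>i\<^esub>(z)\<close> are finite.\<close>

lemma relation_sums_finite:
  fixes l1 :: complex
  assumes i: "i \<in> {1, 2}" and j: "j \<in> {1, 2}"
  defines "W \<equiv> W_current scale q l1 h a0 eQ"
  shows "finite {k::nat. scale (fps_nth f k)
      (mult_z_power 1 (prod_zw (W i) (W j)) (m + int k) (n - int k) v) \<noteq> 0}"
    and "finite {k::nat. scale (fps_nth f k)
      (mult_w_power 1 (prod_wz (W j) (W i)) (m - int k) (n + int k) v) \<noteq> 0}"
proof -
  have fin: "finite {k::nat. scale (fps_nth f k) (W i' (g k) (W j' (n - int k) v)) \<noteq> 0}"
    if ij: "i' \<in> {1, 2}" "j' \<in> {1, 2}" for i' j' and g :: "nat \<Rightarrow> int" and n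
  proof -
    obtain N where N: "\<And>n. n < N \<Longrightarrow> W j' n v = 0"
      using W_current_bounded_below[OF ij(2)] unfolding W_def by blast
    have z: "W i' (g k) (W j' (n - int k) v) = 0" if "k > nat (n - N)" for k
      using N[of "n - int k"] W_current_0[OF ij(1)] that unfolding W_def by simp
    show ?thesis
    proof (rule finite_subset)
      show "{k::nat. scale (fps_nth f k) (W i' (g k) (W j' (n - int k) v)) \<noteq> 0} \<subseteq> {..nat (n - N)}"
      proof
        fix k assume "k \<in> {k::nat. scale (fps_nth f k) (W i' (g k) (W j' (n - int k) v)) \<noteq> 0}"
        hence "W i' (g k) (W j' (n - int k) v) \<noteq> 0" by auto
        thus "k \<in> {..nat (n - N)}" using z[of k] by (cases "k \<le> nat (n - N)") auto
      qed
    qed simp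
  qed
  show "finite {k::nat. scale (fps_nth f k)
      (mult_z_power 1 (prod_zw (W i) (W j)) (m + int k) (n - int k) v) \<noteq> 0}"
    using fin[OF i j] by (simp add: mult_z_power_def prod_zw_def)
  show "finite {k::nat. scale (fps_nth f k)
      (mult_w_power 1 (prod_wz (W j) (W i)) (m - int k) (n + int k) v) \<noteq> 0}"
    using fin[OF j i] by (simp add: mult_w_power_def prod_wz_def)
qed

end

end

theory Submission
  imports Defs
begin

text \<open>
  The idea is to separate every product of two currents into a scalar series and a normally ordered
  product. Write \<open>\<Lambda>\<^sup>\<epsilon>\<^sub>i\<close> (\<open>\<epsilon> = 1, - 1\<close>) for the two halves of \<open>W\<^sub>i\<close>. On an eigenvector of \<open>h\<^bsub>i,0\<^esub>\<close> the
  zero modes of \<open>\<Lambda>\<^sup>\<epsilon>\<^sub>i(z)\<close> contribute only a power of \<open>z\<close>, a power of \<open>q\<close>, and the operators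
  \<open>e\<close> to the \<open>\<epsilon> Q\<^sub>i\<close> and \<open>q\<^sub>1\<close> to the \<open>\<epsilon> a\<^sub>0\<close>, which commute with the nonzero modes
  (\<open>Lam_eigenvector\<close>). In a product of two halves, the right factor shifts the eigenvalue that the left factor sees,
  and this yields one more power of \<open>q\<close> and of the variable of the left factor (\<open>Lam_Lam\<close>). What remains
  are the exponentials \<open>nexp\<close> of the nonzero modes. Moving the annihilation modes of the first past the creation modes of the second costs the exponential of a scalar
  power series in \<open>w / z\<close> (\<open>exp_coeff_weyl\<close>, \<open>nexp_nexp\<close>), and the normally ordered product \<open>nprod\<close>
  that is left over is symmetric in the two factors (\<open>nprod_swap\<close>). So each relation becomes a
  statement about scalar functions.

  For \<open>i = j\<close> and equal signs, the scalar factor together with the zero modes is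
  \<open>z - w\<close> up to a constant, which is antisymmetric, so these terms cancel in the anticommutator. For
  opposite signs, say \<open>\<Lambda>\<^sup>+(z) \<Lambda>\<^sup>-(w)\<close>, it is \<open>q / (z - q\<^sub>2 w)\<close>, expanded in \<open>w / z\<close>, while the product in the
  other order has the factor \<open>- q / (z - q\<^sub>2 w)\<close>, expanded in \<open>z / w\<close>. Their sum is a delta function at \<open>z = q\<^sub>2 w\<close>, where
  the exponents in the normally ordered product of \<open>\<Lambda>\<^sup>+\<close> and \<open>\<Lambda>\<^sup>-\<close> cancel, so that the product is the
  identity (\<open>nprod_cancel\<close>, \<open>Lam_opposite_sign\<close>).

  For \<open>i \<noteq> j\<close> the function \<open>f\<close> is built such that it turns the scalar factor into \<open>1\<close> when the signs
  are equal, and into the quadratic polynomial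
  \<open>(1 - q\<^sub>1 q\<^sub>2 w / z) (1 - q\<^sub>3 q\<^sub>2 w / z)\<close> or \<open>(1 - q\<^sub>1 w / z) (1 - q\<^sub>3 w / z)\<close> when they are opposite
  (\<open>struct_contraction_same_sign\<close>, \<open>struct_contraction_opposite_sign\<close>). After multiplication with the powers of
  \<open>z\<close> and \<open>w\<close> from the zero modes, both orders give the same polynomial because
  \<open>q\<^sub>1 q\<^sub>2 q\<^sub>3 = 1\<close> (\<open>Lam_cross_opposite_sign\<close>). The eigenvectors of \<open>h\<^bsub>i,0\<^esub>\<close> span the module, so it suffices
  to check the relations on them.
\<close>

section \<open>Sums with finite support\<close>

text \<open>The summation sign without a range always stands for \<open>Sum_any\<close> below.\<close>

no_notation suminf (binder "\<Sum>" 10)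

lemma Sum_any_pair:
  fixes g :: "'a \<Rightarrow> 'b \<Rightarrow> 'c::comm_monoid_add"
  assumes "finite {(a, b). g a b \<noteq> 0}"
  shows "(\<Sum>a. \<Sum>b. g a b) = (\<Sum>(a, b). g a b)"
proof (rule Sum_any.cartesian_product)
  let ?S = "{(a, b). g a b \<noteq> 0}"
  show "finite (fst ` ?S \<times> snd ` ?S)" using assms by blast
  show "{a. \<exists>b. g a b \<noteq> 0} \<times> {b. \<exists>a. g a b \<noteq> 0} \<subseteq> fst ` ?S \<times> snd ` ?S"
    by force
qed

lemma Sum_any_swap:
  fixes g :: "'a \<Rightarrow> 'b \<Rightarrow> 'c::comm_monoid_add"
  assumes "finite {(a, b). g a b \<noteq> 0}"
  shows "(\<Sum>a. \<Sum>b. g a b) = (\<Sum>b. \<Sum>a. g a b)"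
proof (rule Sum_any.swap)
  let ?S = "{(a, b). g a b \<noteq> 0}"
  show "finite (fst ` ?S \<times> snd ` ?S)" using assms by blast
  show "{a. \<exists>b. g a b \<noteq> 0} \<times> {b. \<exists>a. g a b \<noteq> 0} \<subseteq> fst ` ?S \<times> snd ` ?S"
    by force
qed

lemma Sum_any_shift:
  fixes g :: "'a::group_add \<Rightarrow> 'b::comm_monoid_add"
  shows "(\<Sum>k. g (k + c)) = (\<Sum>k. g k)"
proof (rule sym, rule Sum_any.reindex_cong[where l = "\<lambda>k. k + c"])
  show "bij (\<lambda>k. k + c)"
    by (rule bij_betw_byWitness[where f' = "\<lambda>k. k - c"]) auto
qed (simp add: fun_eq_iff)

lemma Sum_any_reflect:
  fixes g :: "'a::group_add \<Rightarrow> 'b::comm_monoid_add"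
  shows "(\<Sum>k. g (c - k)) = (\<Sum>k. g k)"
proof (rule sym, rule Sum_any.reindex_cong[where l = "\<lambda>k. c - k"])
  show "bij (\<lambda>k. c - k)"
    by (rule bij_betw_byWitness[where f' = "\<lambda>k. - k + c"]) (auto simp: algebra_simps)
qed (simp add: fun_eq_iff)

lemma Sum_any_reindex_inj:
  fixes f :: "'b \<Rightarrow> 'c::comm_monoid_add"
  assumes "inj g" "\<And>b. b \<notin> range g \<Longrightarrow> f b = 0"
  shows "(\<Sum>a. f (g a)) = (\<Sum>b. f b)"
proof -
  have "{b. f b \<noteq> 0} = g ` {a. f (g a) \<noteq> 0}" using assms(2) by fast
  thus ?thesis unfolding Sum_any.expand_set
    by (simp add: sum.reindex inj_on_subset[OF assms(1)])
qed

text \<open>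
  Two expansions of a rational function that add up to a delta function are the two halves of one
  bilateral series; this glues them together.
\<close>

lemma Sum_any_int_split:
  fixes f :: "int \<Rightarrow> 'c::comm_monoid_add"
  assumes "finite {b. f b \<noteq> 0}"
  shows "(\<Sum>b. f b) = (\<Sum>r. f (B - int r)) + (\<Sum>r. f (B + 1 + int r))"
proof -
  let ?f1 = "\<lambda>b. if b \<le> B then f b else 0" and ?f2 = "\<lambda>b. if b \<le> B then 0 else f b"
  have "(\<Sum>b. f b) = (\<Sum>b. ?f1 b + ?f2 b)"
    by (rule Sum_any.cong) simp
  also have "\<dots> = (\<Sum>b. ?f1 b) + (\<Sum>b. ?f2 b)"
    by (rule Sum_any.distrib; rule finite_subset[OF _ assms]) auto
  also have "(\<Sum>b. ?f1 b) = (\<Sum>r. ?f1 (B - int r))"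
  proof (rule Sum_any_reindex_inj[symmetric])
    show "?f1 b = 0" if "b \<notin> range (\<lambda>r. B - int r)" for b
      using that image_eqI[of b "\<lambda>r. B - int r" "nat (B - b)"] by auto
  qed (simp add: inj_def)
  also have "(\<Sum>b. ?f2 b) = (\<Sum>r. ?f2 (B + 1 + int r))"
  proof (rule Sum_any_reindex_inj[symmetric])
    show "?f2 b = 0" if "b \<notin> range (\<lambda>r. B + 1 + int r)" for b
      using that image_eqI[of b "\<lambda>r. B + 1 + int r" "nat (b - B - 1)"] by auto
  qed (simp add: inj_def)
  finally show ?thesis by simp
qed

lemma finite_Sum_any_support:
  fixes T :: "'a \<Rightarrow> 'b \<Rightarrow> 'c::comm_monoid_add"
  assumes "finite {(a, b). T a b \<noteq> 0}"
  shows "finite {a. (\<Sum>b. T a b) \<noteq> 0}"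
proof (rule finite_subset)
  show "{a. (\<Sum>b. T a b) \<noteq> 0} \<subseteq> fst ` {(a, b). T a b \<noteq> 0}"
    by (force elim: Sum_any.not_neutral_obtains_not_neutral)
qed (use assms in simp)

lemma sum_triangle_swap:
  fixes f :: "nat \<Rightarrow> nat \<Rightarrow> 'c::comm_monoid_add"
  shows "(\<Sum>m=1..n. \<Sum>l=1..n-m. f m l) = (\<Sum>l=1..n. \<Sum>m=1..n-l. f m l)"
  unfolding sum.Sigma[OF finite_atLeastAtMost ballI[OF finite_atLeastAtMost]]
  by (rule sum.reindex_bij_witness[where i = "\<lambda>(x, y). (y, x)" and j = "\<lambda>(x, y). (y, x)"]) auto

lemma sum_square_eq_triangle:
  fixes f :: "nat \<Rightarrow> nat \<Rightarrow> 'a::comm_monoid_add"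
  assumes "\<And>m r. m + r > n \<Longrightarrow> f m r = 0"
  shows "(\<Sum>m\<le>n. \<Sum>r\<le>n. f m r) = (\<Sum>k\<le>n. \<Sum>m\<le>k. f m (k - m))"
proof -
  have "(\<Sum>m\<le>n. \<Sum>r\<le>n. f m r) = (\<Sum>(m, r)\<in>{..n} \<times> {..n}. f m r)"
    by (rule sum.cartesian_product)
  also have "\<dots> = (\<Sum>(m, r)\<in>{(m, r). m + r \<le> n}. f m r)"
    by (rule sum.mono_neutral_right) (auto intro: ccontr simp: assms)
  finally show ?thesis by (simp add: sum.triangle_reindex_eq)
qed

section \<open>Exponentials of scalar power series\<close>

text \<open>
  The differential equation determines the coefficients recursively, because the coefficient of index
  \<open>n + 1\<close> appears in it with the nonzero factor \<open>n + 1\<close>. All identities between exponentials of scalar series are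
  derived from it.
\<close>

lemma fps_log_deriv_unique:
  fixes F G \<gamma> :: "'a::field_char_0 fps"
  assumes "fps_nth F 0 = fps_nth G 0"
    and F: "fps_deriv F = fps_deriv \<gamma> * F" and G: "fps_deriv G = fps_deriv \<gamma> * G"
  shows "F = G"
proof (rule fps_ext)
  fix n
  show "fps_nth F n = fps_nth G n"
  proof (induction n rule: less_induct)
    case (less n)
    show ?case
    proof (cases n)
      case (Suc m)
      have "of_nat (Suc m) * fps_nth F (Suc m) = of_nat (Suc m) * fps_nth G (Suc m)"
        using arg_cong[OF F, of "\<lambda>f. fps_nth f m"] arg_cong[OF G, of "\<lambda>f. fps_nth f m"] less Suc
        by (simp add: fps_mult_nth)
      thus ?thesis unfolding Suc by (simp only: mult_cancel_left of_nat_eq_0_iff) simp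
    qed (use assms in simp)
  qed
qed

abbreviation fps_exp_of :: "'a::field_char_0 fps \<Rightarrow> 'a fps" where
  "fps_exp_of \<gamma> \<equiv> fps_compose (fps_exp 1) \<gamma>"

lemma fps_exp_of_deriv:
  "fps_nth \<gamma> 0 = 0 \<Longrightarrow> fps_deriv (fps_exp_of \<gamma>) = fps_deriv \<gamma> * fps_exp_of \<gamma>"
  by (simp add: fps_compose_deriv mult.commute)

lemma fps_exp_of_eqI:
  assumes "fps_nth \<gamma> 0 = 0" "fps_nth G 0 = 1" "fps_deriv G = fps_deriv \<gamma> * G"
  shows "fps_exp_of \<gamma> = G"
  by (rule fps_log_deriv_unique[of _ _ \<gamma>]) (use assms fps_exp_of_deriv in auto)

lemma fps_exp_of_add:
  assumes "fps_nth \<gamma> 0 = 0" "fps_nth \<gamma>' 0 = 0"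
  shows "fps_exp_of (\<gamma> + \<gamma>') = fps_exp_of \<gamma> * fps_exp_of \<gamma>'"
  by (rule fps_exp_of_eqI) (use assms in \<open>auto simp: fps_exp_of_deriv algebra_simps\<close>)

text \<open>The power series of \<open>log (1 - t x)\<close>.\<close>

definition fps_log_one_minus :: "'a::field_char_0 \<Rightarrow> 'a fps" where
  "fps_log_one_minus t = Abs_fps (\<lambda>n. if n = 0 then 0 else - (t ^ n / of_nat n))"

lemma fps_deriv_log_one_minus: "fps_deriv (fps_log_one_minus t) = fps_const (- t) * Abs_fps (\<lambda>n. t ^ n)"
  by (rule fps_ext) (simp add: fps_log_one_minus_def del: of_nat_Suc)

lemma fps_geometric_mult: "Abs_fps (\<lambda>n. t ^ n) * (1 - fps_const t * fps_X) = (1 :: 'a::field_char_0 fps)"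
proof -
  have "Abs_fps (\<lambda>n. t ^ n) - Abs_fps (\<lambda>n. t ^ n) * fps_X * fps_const t = (1 :: 'a::field_char_0 fps)"
  proof (rule fps_ext)
    fix n
    show "fps_nth (Abs_fps (\<lambda>n. t ^ n) - Abs_fps (\<lambda>n. t ^ n) * fps_X * fps_const t) n
        = fps_nth (1 :: 'a::field_char_0 fps) n"
      by (cases n) simp_all
  qed
  thus ?thesis by (simp add: algebra_simps)
qed

lemma fps_exp_of_log_one_minus: "fps_exp_of (fps_log_one_minus t) = 1 - fps_const t * fps_X"
proof (rule fps_exp_of_eqI)
  show "fps_deriv (1 - fps_const t * fps_X) = fps_deriv (fps_log_one_minus t) * (1 - fps_const t * fps_X)"
    unfolding fps_deriv_log_one_minus mult.assoc fps_geometric_mult by simp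
qed (simp_all add: fps_log_one_minus_def)

lemma fps_exp_of_minus_log_one_minus: "fps_exp_of (- fps_log_one_minus t) = Abs_fps (\<lambda>n. t ^ n)"
proof -
  have "fps_exp_of (- fps_log_one_minus t) * fps_exp_of (fps_log_one_minus t) = 1"
    by (subst fps_exp_of_add[symmetric]) (auto simp: fps_log_one_minus_def)
  hence "fps_exp_of (- fps_log_one_minus t) * ((1 - fps_const t * fps_X) * Abs_fps (\<lambda>n. t ^ n)) = Abs_fps (\<lambda>n. t ^ n)"
    unfolding fps_exp_of_log_one_minus by (simp add: mult.assoc[symmetric])
  thus ?thesis by (simp add: mult.commute[of "1 - fps_const t * fps_X"] fps_geometric_mult)
qed

text \<open>
  This is the recursion from the Euler operator \<open>x d/dx\<close>, in the same form as the one for exponentials of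
  operators in \<open>exp_coeff_rec\<close>.
\<close>

lemma fps_exp_of_nth:
  assumes "fps_nth \<gamma> 0 = 0"
  shows "of_nat n * fps_nth (fps_exp_of \<gamma>) n
    = (\<Sum>m\<le>n. of_nat m * fps_nth \<gamma> m * fps_nth (fps_exp_of \<gamma>) (n - m))"
proof -
  have "fps_XD (fps_exp_of \<gamma>) = fps_XD \<gamma> * fps_exp_of \<gamma>"
    unfolding fps_XD_def o_apply fps_exp_of_deriv[OF assms] by (simp add: mult.assoc)
  from arg_cong[OF this, of "\<lambda>f. fps_nth f n"] show ?thesis
    by (simp add: fps_mult_nth atLeast0AtMost)
qed

section \<open>Linear operators\<close>

text \<open>
  A locale of its own keeps the abbreviations and lemmas below apart from the many interpretations of
  \<open>vector_space\<close>.
\<close>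

locale complex_vector_space = vector_space scale
  for scale :: "complex \<Rightarrow> 'v \<Rightarrow> 'v::ab_group_add"
begin

abbreviation lin :: "('v \<Rightarrow> 'v) \<Rightarrow> bool" where
  "lin \<equiv> Vector_Spaces.linear scale scale"

lemma
  fixes f :: "'v \<Rightarrow> 'v"
  assumes "lin f"
  shows lin_add: "f (x + y) = f x + f y"
    and lin_diff: "f (x - y) = f x - f y"
    and lin_neg: "f (- x) = - f x"
    and lin_scale: "f (scale c x) = scale c (f x)"
    and lin_0: "f 0 = 0"
    and lin_sum: "f (sum g S) = (\<Sum>s\<in>S. f (g s))"
  using Vector_Spaces.linear.axioms(3)[OF assms]
  by (simp_all add: module_hom.add module_hom.diff module_hom.neg module_hom.scale module_hom.zero
    module_hom.sum)

lemma linI: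
  assumes "\<And>x y. f (x + y) = f x + f y" "\<And>c x. f (scale c x) = scale c (f x)"
  shows "lin f"
  by (intro Vector_Spaces.linear.intro module_hom.intro module_hom_axioms.intro
     vector_space_axioms module_axioms) (use assms in auto)

lemma lin_Sum_any:
  assumes f: "lin f" and "finite {a. g a \<noteq> 0}"
  shows "f (\<Sum>a. g a) = (\<Sum>a. f (g a))"
proof -
  have "(\<Sum>a. f (g a)) = (\<Sum>a\<in>{a. g a \<noteq> 0}. f (g a))"
    by (rule Sum_any.expand_superset) (use assms lin_0[OF f] in auto)
  thus ?thesis by (simp add: Sum_any.expand_set lin_sum[OF f])
qed

lemma lin_scale_op: "lin (scale c)"
  by (rule linI) (simp_all add: scale_right_distrib scale_scale mult.commute)

lemma scale_Sum_any: "finite {a. g a \<noteq> 0} \<Longrightarrow> scale c (\<Sum>a. g a) = (\<Sum>a. scale c (g a))"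
  by (rule lin_Sum_any[OF lin_scale_op])

lemma lin_comp: "lin f \<Longrightarrow> lin g \<Longrightarrow> lin (\<lambda>v. f (g v))"
  by (rule linI) (simp_all add: lin_add lin_scale)

lemma lin_plus: "lin f \<Longrightarrow> lin g \<Longrightarrow> lin (\<lambda>v. f v + g v)"
  by (rule linI) (simp_all add: lin_add lin_scale scale_right_distrib)

lemma lin_SumI: "(\<And>s. s \<in> S \<Longrightarrow> lin (g s)) \<Longrightarrow> lin (\<lambda>v. \<Sum>s\<in>S. g s v)"
  by (rule linI) (simp_all add: lin_add lin_scale sum.distrib scale_sum_right)

lemma lin_Sum_anyI:
  assumes "\<And>k. lin (g k)" "\<And>v. finite {k. g k v \<noteq> 0}"
  shows "lin (\<lambda>v. \<Sum>k. g k v)"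
proof (rule linI)
  show "(\<Sum>k. g k (x + y)) = (\<Sum>k. g k x) + (\<Sum>k. g k y)" for x y
    by (simp add: lin_add[OF assms(1)] Sum_any.distrib[OF assms(2) assms(2)])
  show "(\<Sum>k. g k (scale c x)) = scale c (\<Sum>k. g k x)" for c x
    by (simp add: lin_scale[OF assms(1)] scale_Sum_any[OF assms(2)])
qed

lemma lin_zero_op: "lin (\<lambda>v. 0)"
  by (rule linI) simp_all

lemma lin_inv:
  assumes "lin g" "bij g"
  shows "lin (inv g)"
proof (rule linI)
  have g: "inv g (g x) = x" "g (inv g x) = x" for x
    using assms(2) by (simp_all add: bij_is_inj bij_is_surj surj_f_inv_f)
  show "inv g (x + y) = inv g x + inv g y" for x y
    by (metis g lin_add[OF assms(1)])
  show "inv g (scale c x) = scale c (inv g x)" for c x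
    by (metis g lin_scale[OF assms(1)])
qed

lemma lin_eq_on_span:
  assumes "lin F" "lin G" "span E = UNIV" "\<And>v. v \<in> E \<Longrightarrow> F v = G v"
  shows "F v = G v"
proof -
  interpret P: vector_space_pair scale scale ..
  show ?thesis by (rule P.linear_eq_on[of F G v E]) (use assms in auto)
qed

text \<open>
  Both \<open>f(w / z)\<close> and the scalar factor of a product of currents act by shifts along an antidiagonal, so their
  composition is the action of the product of the two power series.
\<close>

lemma Sum_any_fps_mult:
  assumes "finite {R::nat. G R \<noteq> 0}"
  shows "(\<Sum>k. scale (fps_nth f k) (\<Sum>r. scale (fps_nth g r) (G (k + r)))) = (\<Sum>R. scale (fps_nth (f * g) R) (G R))"
proof -
  obtain B where "\<forall>R\<in>{R. G R \<noteq> 0}. R \<le> B"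
    using finite_nat_set_iff_bounded_le assms by blast
  hence B: "G R = 0" if "R > B" for R using that by fastforce
  have fin: "(\<Sum>R. T R) = (\<Sum>R\<le>B. T R)" if "\<And>R. R > B \<Longrightarrow> T R = 0" for T :: "nat \<Rightarrow> 'v"
    by (rule Sum_any.expand_superset) (use that in \<open>auto intro!: leI\<close>)
  have "(\<Sum>k. scale (fps_nth f k) (\<Sum>r. scale (fps_nth g r) (G (k + r))))
      = (\<Sum>k\<le>B. \<Sum>r\<le>B. scale (fps_nth f k * fps_nth g r) (G (k + r)))"
    by (simp add: fin B scale_sum_right)
  also have "\<dots> = (\<Sum>R\<le>B. \<Sum>k\<le>R. scale (fps_nth f k * fps_nth g (R - k)) (G (k + (R - k))))"
    by (rule sum_square_eq_triangle) (simp add: B)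
  also have "\<dots> = (\<Sum>R\<le>B. scale (fps_nth (f * g) R) (G R))"
    by (rule sum.cong) (simp_all add: fps_mult_nth atLeast0AtMost scale_sum_left)
  also have "\<dots> = (\<Sum>R. scale (fps_nth (f * g) R) (G R))"
    by (simp add: fin B)
  finally show ?thesis .
qed

lemma Sum_any_fps_quadratic:
  "(\<Sum>R. scale (fps_nth ((1 - fps_const x * fps_X) * (1 - fps_const y * fps_X)) R) (G R))
    = G 0 - scale (x + y) (G 1) + scale (x * y) (G 2)" (is "(\<Sum>R. ?f R) = _")
proof -
  have nth: "fps_nth ((1 - fps_const x * fps_X) * (1 - fps_const y * fps_X)) R
      = (if R = 0 then 1 else if R = 1 then - (x + y) else if R = 2 then x * y else 0)" for R
  proof -
    have eq: "(1 - fps_const x * fps_X) * (1 - fps_const y * fps_X)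
      = 1 - fps_const (x + y) * fps_X + fps_const (x * y) * fps_X ^ 2"
      by (simp add: algebra_simps power2_eq_square flip: fps_const_add fps_const_mult)
    show ?thesis unfolding eq
      by (simp add: fps_X_power_nth del: fps_const_add fps_const_mult)
  qed
  have "{R. ?f R \<noteq> 0} \<subseteq> {0, 1, 2}" by (auto simp: nth)
  hence "(\<Sum>R. ?f R) = (\<Sum>R\<in>{0,1,2}. ?f R)" by (intro Sum_any.expand_superset) auto
  also have "\<dots> = G 0 - scale (x + y) (G 1) + scale (x * y) (G 2)"
    unfolding nth by (simp add: scale_left_distrib scale_left_diff_distrib)
  finally show ?thesis .
qed

lemma Sum_any_fps_linear:
  "(\<Sum>R. scale (fps_nth (1 - fps_const x * fps_X) R) (G R)) = G 0 - scale x (G 1)"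
  using Sum_any_fps_quadratic[of x 0 G] by simp

lemma Sum_any_fps_one: "(\<Sum>R. scale (fps_nth 1 R) (G R)) = G 0"
  using Sum_any_fps_linear[of 0 G] by simp

section \<open>Exponentials of commuting families of operators\<close>

lemma lin_ser_pow: "(\<And>m. lin (a m)) \<Longrightarrow> lin (ser_pow a k n)"
proof (induction k arbitrary: n)
  case 0
  show ?case by (rule linI) simp_all
next
  case (Suc k)
  have "lin (\<lambda>v. \<Sum>m=1..n. a m (ser_pow a k (n - m) v))"
    by (rule lin_SumI, rule lin_comp[OF Suc.prems Suc.IH[OF Suc.prems]])
  moreover have "ser_pow a (Suc k) n = (\<lambda>v. \<Sum>m=1..n. a m (ser_pow a k (n - m) v))"
    by (rule ext) simp
  ultimately show ?case by simp
qed

lemma ser_pow_eq_0: "(\<And>m. lin (a m)) \<Longrightarrow> n < k \<Longrightarrow> ser_pow a k n v = 0"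
proof (induction k arbitrary: n)
  case (Suc k)
  have "a m (ser_pow a k (n - m) v) = 0" if "m \<in> {1..n}" for m
  proof -
    have "n - m < k" using Suc.prems(2) that by auto
    from Suc.IH[OF Suc.prems(1) this] show ?thesis by (simp add: lin_0[OF Suc.prems(1)])
  qed
  thus ?case by simp
qed simp

text \<open>
  With \<open>A = a 1 x + a 2 x\<^sup>2 + \<dots>\<close> this is the coefficient form of
  \<open>x d/dx A\<^bsup>k + 1\<^esup> = (k + 1) (x dA/dx) A\<^bsup>k\<^esup>\<close>, which needs that the coefficients of \<open>A\<close> commute.
\<close>

lemma ser_pow_rec:
  assumes lin: "\<And>m. lin (a m)" and comm: "\<And>m n v. a m (a n v) = a n (a m v)"
  shows "scale (of_nat n) (ser_pow a (Suc k) n v)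
    = scale (of_nat (Suc k)) (\<Sum>m=1..n. scale (of_nat m) (a m (ser_pow a k (n - m) v)))"
proof (induction k arbitrary: n)
  case 0
  show ?case by (auto simp: scale_sum_right lin_0[OF lin] intro!: sum.cong)
next
  case (Suc k)
  let ?p = "ser_pow a" and ?s = "\<lambda>n. scale (of_nat n)"
  let ?A = "\<Sum>m=1..n. ?s m (a m (?p (Suc k) (n - m) v))"
  have "?s n (?p (Suc (Suc k)) n v) = (\<Sum>m=1..n. ?s n (a m (?p (Suc k) (n - m) v)))"
    by (simp only: ser_pow.simps(2)[of a "Suc k"] scale_sum_right)
  also have "\<dots> = ?A + (\<Sum>m=1..n. a m (?s (n - m) (?p (Suc k) (n - m) v)))"
    unfolding sum.distrib[symmetric]
    by (intro sum.cong refl)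
      (simp add: lin_scale[OF lin] lin_diff[OF lin] of_nat_diff scale_left_diff_distrib del: ser_pow.simps(2))
  also have "(\<Sum>m=1..n. a m (?s (n - m) (?p (Suc k) (n - m) v)))
      = (\<Sum>m=1..n. \<Sum>l=1..n-m. ?s (Suc k) (?s l (a l (a m (?p k (n - m - l) v)))))"
    unfolding Suc scale_sum_right lin_sum[OF lin] lin_scale[OF lin]
    by (intro sum.cong refl arg_cong[where f = "scale _"]) (rule comm)
  also have "\<dots> = (\<Sum>l=1..n. \<Sum>m=1..n-l. ?s (Suc k) (?s l (a l (a m (?p k (n - l - m) v)))))"
    by (subst sum_triangle_swap) (simp add: add.commute)
  also have "\<dots> = ?s (Suc k) ?A"
    by (simp only: scale_sum_right lin_sum[OF lin] ser_pow.simps(2))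
  also have "?A + ?s (Suc k) ?A = ?s (Suc (Suc k)) ?A"
    by (simp only: of_nat_Suc scale_left_distrib scale_one add.assoc)
  finally show ?case .
qed

text \<open>
  Coefficients are indexed by integers, with value \<open>0\<close> at negative indices, so that indices can be shifted freely in
  bilateral sums.
\<close>

definition exp_coeff :: "(nat \<Rightarrow> 'v \<Rightarrow> 'v) \<Rightarrow> int \<Rightarrow> 'v \<Rightarrow> 'v" where
  "exp_coeff a k v = (if k \<ge> 0 then ser_exp scale a (nat k) v else 0)"

lemma exp_coeff_neg: "k < 0 \<Longrightarrow> exp_coeff a k v = 0"
  by (simp add: exp_coeff_def)

lemma exp_coeff_0: "exp_coeff a 0 v = v"
  by (simp add: exp_coeff_def ser_exp_def)

lemma lin_exp_coeff:
  assumes "\<And>m. lin (a m)"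
  shows "lin (exp_coeff a k)"
proof -
  have "lin (\<lambda>v. \<Sum>j\<le>nat k. scale (1 / fact j) (ser_pow a j (nat k) v))"
    by (intro lin_SumI lin_comp[OF lin_scale_op] lin_ser_pow assms)
  moreover have "exp_coeff a k
      = (if k \<ge> 0 then (\<lambda>v. \<Sum>j\<le>nat k. scale (1 / fact j) (ser_pow a j (nat k) v)) else (\<lambda>v. 0))"
    by (auto simp: fun_eq_iff exp_coeff_def ser_exp_def)
  ultimately show ?thesis by (simp add: lin_zero_op)
qed

text \<open>
  Applying \<open>x d/dx\<close> to \<open>exp A\<close> gives \<open>(x dA/dx) exp A\<close>. This recursion replaces the double sums in the definition of
  the exponential in everything that follows. The summation bound \<open>B\<close> is arbitrary, because terms with \<open>m > k\<close> vanish
  and the term with \<open>m = 0\<close> has the factor \<open>0\<close>.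
\<close>

lemma exp_coeff_rec:
  assumes lin: "\<And>m. lin (a m)" and comm: "\<And>m n v. a m (a n v) = a n (a m v)"
    and B: "k \<le> int B"
  shows "scale (of_int k) (exp_coeff a k v)
    = (\<Sum>m\<le>B. scale (of_nat m) (a m (exp_coeff a (k - int m) v)))"
proof (cases "k \<ge> 0")
  case True
  define n where "n = nat k"
  have k: "k = int n" using True by (simp add: n_def)
  let ?p = "ser_pow a" and ?s = "\<lambda>n. scale (of_nat n)"
  have "?s n (ser_exp scale a n v) = (\<Sum>j\<le>n. scale (1 / fact j) (?s n (?p j n v)))"
    by (simp add: ser_exp_def scale_sum_right mult.commute)
  also have "\<dots> = (\<Sum>j<n. scale (1 / fact (Suc j)) (?s n (?p (Suc j) n v)))"
    by (subst sum.atMost_shift) simp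
  also have "\<dots> = (\<Sum>j<n. scale (1 / fact j) (\<Sum>m=1..n. ?s m (a m (?p j (n - m) v))))"
    unfolding ser_pow_rec[of a, OF lin comm] scale_scale
    by (intro sum.cong refl arg_cong2[where f = scale]) (simp del: of_nat_Suc)
  also have "\<dots> = (\<Sum>m=1..n. \<Sum>j<n. scale (1 / fact j) (?s m (a m (?p j (n - m) v))))"
    unfolding scale_sum_right by (rule sum.swap)
  also have "\<dots> = (\<Sum>m=1..n. ?s m (a m (ser_exp scale a (n - m) v)))"
  proof (rule sum.cong[OF refl])
    fix m assume m: "m \<in> {1..n}"
    have "(\<Sum>j<n. scale (1 / fact j) (?s m (a m (?p j (n - m) v))))
        = (\<Sum>j\<le>n-m. scale (1 / fact j) (?s m (a m (?p j (n - m) v))))"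
      by (rule sum.mono_neutral_right) (use m in \<open>auto simp: ser_pow_eq_0[OF lin] lin_0[OF lin]\<close>)
    thus "(\<Sum>j<n. scale (1 / fact j) (?s m (a m (?p j (n - m) v)))) = ?s m (a m (ser_exp scale a (n - m) v))"
      by (simp add: ser_exp_def scale_sum_right lin_sum[OF lin] lin_scale[OF lin] mult.commute)
  qed
  also have "\<dots> = (\<Sum>m=1..n. ?s m (a m (exp_coeff a (k - int m) v)))"
    by (rule sum.cong[OF refl]) (auto simp: exp_coeff_def k nat_diff_distrib)
  also have "\<dots> = (\<Sum>m\<le>B. ?s m (a m (exp_coeff a (k - int m) v)))"
    by (rule sum.mono_neutral_left) (use B in \<open>auto simp: k exp_coeff_neg lin_0[OF lin] not_le\<close>)
  finally show ?thesis by (simp add: exp_coeff_def k)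
qed (simp add: exp_coeff_neg lin_0[OF lin])

text \<open>
  If \<open>[D, A] = \<kappa> x\<^sup>p\<close> is central, then \<open>[D, exp A] = \<kappa> x\<^sup>p exp A\<close>. In the recursion for the
  coefficients, the commutator of \<open>D\<close> with the factor \<open>a p\<close> and those with the remaining factors contribute
  \<open>p\<close> and \<open>k - p\<close> times the same term.
\<close>

lemma exp_coeff_derivation:
  assumes lin: "\<And>m. lin (a m)" and comm: "\<And>m n v. a m (a n v) = a n (a m v)"
    and D: "lin D" "\<And>m v. m > 0 \<Longrightarrow> D (a m v) = a m (D v) + (if m = p then scale \<kappa> v else 0)"
    and p: "p > 0"
  shows "D (exp_coeff a k v) = exp_coeff a k (D v) + scale \<kappa> (exp_coeff a (k - int p) v)"
proof (induction "nat k" arbitrary: k rule: less_induct)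
  case less
  consider "k < 0" | "k = 0" | "k > 0" by linarith
  thus ?case
  proof cases
    case 3
    define B where "B = nat k"
    have k: "k = int B" using 3 by (simp add: B_def)
    let ?E = "exp_coeff a" and ?s = "\<lambda>m. scale (of_nat m)"
    have "scale (of_int k) (D (?E k v)) = (\<Sum>m\<le>B. ?s m (D (a m (?E (k - int m) v))))"
      using exp_coeff_rec[OF lin comm, where k = k and B = B and v = v]
      by (simp add: k lin_sum[OF D(1)] flip: lin_scale[OF D(1)])
    also have "\<dots> = (\<Sum>m\<le>B. ?s m (a m (?E (k - int m) (D v)))
         + scale \<kappa> (?s m (a m (?E (k - int p - int m) v)))
         + (if m = p then scale (of_nat p * \<kappa>) (?E (k - int p) v) else 0))"
    proof (rule sum.cong[OF refl])
      fix m assume "m \<in> {..B}"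
      show "?s m (D (a m (?E (k - int m) v))) = ?s m (a m (?E (k - int m) (D v)))
         + scale \<kappa> (?s m (a m (?E (k - int p - int m) v)))
         + (if m = p then scale (of_nat p * \<kappa>) (?E (k - int p) v) else 0)"
      proof (cases "m = 0")
        case False
        hence "D (?E (k - int m) v) = ?E (k - int m) (D v) + scale \<kappa> (?E (k - int m - int p) v)"
          using less 3 by simp
        thus ?thesis using False
          by (auto simp: D(2) lin_add[OF lin] lin_scale[OF lin] scale_right_distrib algebra_simps)
      qed (use p in simp)
    qed
    also have "\<dots> = scale (of_int k) (?E k (D v)) + scale \<kappa> (scale (of_int (k - int p)) (?E (k - int p) v))
        + scale (of_nat p * \<kappa>) (?E (k - int p) v)"
      unfolding sum.distrib scale_sum_right[symmetric]
      by (subst (1 2) exp_coeff_rec[OF lin comm, where B = B, symmetric])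
        (auto simp: k exp_coeff_neg)
    also have "\<dots> = scale (of_int k) (?E k (D v) + scale \<kappa> (?E (k - int p) v))"
      by (simp add: k algebra_simps)
    finally show ?thesis using 3 by simp
  qed (use p in \<open>simp_all add: exp_coeff_neg exp_coeff_0 lin_0[OF D(1)]\<close>)
qed

lemma exp_coeff_commute:
  assumes "\<And>m. lin (a m)" "\<And>m n v. a m (a n v) = a n (a m v)"
    and "lin D" "\<And>m v. m > 0 \<Longrightarrow> D (a m v) = a m (D v)"
  shows "D (exp_coeff a k v) = exp_coeff a k (D v)"
  using exp_coeff_derivation[of a D 1 0, OF assms(1-3)] assms(4) by simp

text \<open>
  The formula \<open>exp A exp B = exp [A, B] exp B exp A\<close> for a central commutator, where \<open>A\<close> and \<open>B\<close> are
  series in \<open>1 / z\<close> and \<open>w\<close>, so that \<open>exp [A, B]\<close> is a power series in \<open>w / z\<close>. By induction on \<open>k\<close>: in the recursion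
  for \<open>exp A\<close>, moving the leading \<open>a m\<close> past \<open>exp B\<close> produces the recursion for the scalar series \<open>exp [A, B]\<close>.
\<close>

lemma exp_coeff_weyl:
  assumes lin: "\<And>m. lin (a m)" "\<And>m. lin (b m)"
    and comm: "\<And>m n v. a m (a n v) = a n (a m v)" "\<And>m n v. b m (b n v) = b n (b m v)"
    and ab: "\<And>m n v. m > 0 \<Longrightarrow> a m (b n v) = b n (a m v) + (if n = m then scale (\<kappa> m) v else 0)"
    and \<gamma>: "\<And>m. m > 0 \<Longrightarrow> fps_nth \<gamma> m = \<kappa> m" "fps_nth \<gamma> 0 = 0"
    and B: "k \<le> int B"
  shows "exp_coeff a k (exp_coeff b n v)
    = (\<Sum>r\<le>B. scale (fps_nth (fps_exp_of \<gamma>) r) (exp_coeff b (n - int r) (exp_coeff a (k - int r) v)))"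
  using B
proof (induction "nat k" arbitrary: k rule: less_induct)
  case less
  let ?A = "exp_coeff a" and ?B = "exp_coeff b" and ?s = "\<lambda>m. scale (of_nat m)"
  let ?g = "fps_nth (fps_exp_of \<gamma>)"
  have linA: "lin (?A k)" and linB: "lin (?B k)" for k by (simp_all add: lin_exp_coeff lin)
  consider "k < 0" | "k = 0" | "k > 0" by linarith
  thus ?case
  proof cases
    case 1
    thus ?thesis by (simp add: exp_coeff_neg lin_0[OF linB])
  next
    case 2
    have "(\<Sum>r\<le>B. scale (?g r) (?B (n - int r) (?A (k - int r) v))) = (\<Sum>r\<in>{0}. scale (?g r) (?B (n - int r) (?A (k - int r) v)))"
      by (rule sum.mono_neutral_right) (auto simp: 2 exp_coeff_neg lin_0[OF linB])
    thus ?thesis by (simp add: 2 exp_coeff_0)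
  next
    case 3
    \<comment> \<open>The commutator of \<open>a m\<close> with \<open>b m\<close> is central, so that \<open>a m\<close> acts on \<open>exp B\<close> as a derivation.\<close>
    have der: "a m (?B j v) = ?B j (a m v) + scale (\<kappa> m) (?B (j - int m) v)" if "m > 0" for m j v
      by (rule exp_coeff_derivation[OF lin(2) comm(2) lin(1)]) (use ab that in auto)
    let ?H = "\<lambda>r. ?B (n - int r) (?A (k - int r) v)"
    have "scale (of_int k) (?A k (?B n v)) = (\<Sum>m\<le>B. ?s m (a m (?A (k - int m) (?B n v))))"
      by (rule exp_coeff_rec[OF lin(1) comm(1) less.prems])
    also have "\<dots> = (\<Sum>m\<le>B. \<Sum>r\<le>B. scale (?g r) (?B (n - int r) (?s m (a m (?A (k - int r - int m) v))))
        + scale (of_nat m * fps_nth \<gamma> m * ?g r) (?H (r + m)))"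
    proof (rule sum.cong[OF refl])
      fix m
      show "?s m (a m (?A (k - int m) (?B n v))) =
        (\<Sum>r\<le>B. scale (?g r) (?B (n - int r) (?s m (a m (?A (k - int r - int m) v))))
          + scale (of_nat m * fps_nth \<gamma> m * ?g r) (?H (r + m)))"
      proof (cases "m = 0")
        case False
        hence "?A (k - int m) (?B n v) = (\<Sum>r\<le>B. scale (?g r) (?B (n - int r) (?A (k - int m - int r) v)))"
          using 3 less by simp
        thus ?thesis using False
          by (simp add: lin_sum[OF lin(1)] lin_scale[OF lin(1)] lin_scale[OF linB] scale_sum_right der
            scale_right_distrib \<gamma> algebra_simps)
      qed (simp add: lin_0[OF linB])
    qed
    also have "\<dots> = (\<Sum>r\<le>B. scale (?g r) (?B (n - int r) (\<Sum>m\<le>B. ?s m (a m (?A (k - int r - int m) v)))))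
        + (\<Sum>m\<le>B. \<Sum>r\<le>B. scale (of_nat m * fps_nth \<gamma> m * ?g r) (?H (r + m)))"
      unfolding sum.distrib lin_sum[OF linB] scale_sum_right
      by (subst (2) sum.swap) (rule refl)
    also have "(\<Sum>r\<le>B. scale (?g r) (?B (n - int r) (\<Sum>m\<le>B. ?s m (a m (?A (k - int r - int m) v)))))
        = (\<Sum>r\<le>B. scale (?g r * of_int (k - int r)) (?H r))"
      by (subst exp_coeff_rec[OF lin(1) comm(1), symmetric]) (use less.prems in \<open>simp_all add: lin_scale[OF linB]\<close>)
    also have "(\<Sum>m\<le>B. \<Sum>r\<le>B. scale (of_nat m * fps_nth \<gamma> m * ?g r) (?H (r + m)))
       = (\<Sum>r\<le>B. \<Sum>m\<le>r. scale (of_nat m * fps_nth \<gamma> m * ?g (r - m)) (?H (r - m + m)))"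
      by (rule sum_square_eq_triangle) (use less.prems in \<open>simp add: exp_coeff_neg lin_0[OF linB]\<close>)
    also have "\<dots> = (\<Sum>r\<le>B. scale (of_nat r * ?g r) (?H r))"
      unfolding fps_exp_of_nth[OF \<gamma>(2)] scale_sum_left by (intro sum.cong refl) simp
    also have "(\<Sum>r\<le>B. scale (?g r * of_int (k - int r)) (?H r)) + (\<Sum>r\<le>B. scale (of_nat r * ?g r) (?H r))
       = scale (of_int k) (\<Sum>r\<le>B. scale (?g r) (?H r))"
      unfolding sum.distrib[symmetric] scale_sum_right scale_left_distrib[symmetric] scale_scale
      by (intro sum.cong refl) (simp add: algebra_simps)
    finally show ?thesis using 3 by simp
  qed
qed

text \<open>
  The identity \<open>exp (A(x z)) exp (- A(x z)) = 1\<close>, with \<open>B(z) = - A(x z)\<close>. By the recursion, \<open>t\<close> times the sum is a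
  difference of two sums that agree after a shift of \<open>j\<close>.
\<close>

lemma exp_coeff_cancel:
  assumes lin: "\<And>m. lin (a m)" "\<And>m. lin (b m)"
    and comm: "\<And>m n v. a m (a n v) = a n (a m v)" "\<And>m n v. b m (b n v) = b n (b m v)"
      "\<And>m n v. a m (b n v) = b n (a m v)"
    and ba: "\<And>m v. m > 0 \<Longrightarrow> b m v = scale (- (x powi int m)) (a m v)" and x: "x \<noteq> 0"
  shows "(\<Sum>j::int. scale (x powi (t - j)) (exp_coeff a (t - j) (exp_coeff b j v))) = (if t = 0 then v else 0)"
proof -
  let ?A = "exp_coeff a" and ?B = "exp_coeff b" and ?s = "\<lambda>m. scale (of_nat m)"
  have linA: "lin (?A k)" and linB: "lin (?B k)" for k by (simp_all add: lin_exp_coeff lin)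
  have aA: "a m (?A k v) = ?A k (a m v)" for m k v
    by (rule exp_coeff_commute) (use lin comm in auto)
  let ?f = "\<lambda>j. scale (x powi (t - j)) (?A (t - j) (?B j v))"
  let ?S = "\<Sum>j\<in>{0..t}. ?f j"
  have S: "(\<Sum>j. ?f j) = ?S"
  proof (rule Sum_any.expand_superset)
    have "?f j = 0" if "\<not> (0 \<le> j \<and> j \<le> t)" for j
      using that by (cases "j < 0") (auto simp: exp_coeff_neg lin_0[OF linA])
    thus "{j. ?f j \<noteq> 0} \<subseteq> {0..t}" by fastforce
  qed simp
  consider "t < 0" | "t = 0" | "t > 0" by linarith
  thus ?thesis
  proof cases
    case 3
    define N where "N = nat t"
    have t: "t = int N" using 3 by (simp add: N_def)
    let ?F = "\<lambda>m j. scale (x powi (t - j) * of_nat m) (a m (?A (t - j - int m) (?B j v)))"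
    \<comment> \<open>Nothing is lost at the ends of the range, where one of the two exponentials has a negative index.\<close>
    have shifted: "(\<Sum>j\<in>{0..t}. ?F m j) = (\<Sum>j\<in>{0..t}. ?F m (j - int m))" for m
    proof -
      have "(\<Sum>j\<in>{0..t}. ?F m j) = (\<Sum>j. ?F m j)"
      proof (rule Sum_any.expand_superset[symmetric])
        have "?F m j = 0" if "\<not> (0 \<le> j \<and> j \<le> t)" for j
          using that by (cases "j < 0") (auto simp: exp_coeff_neg lin_0[OF linA] lin_0[OF lin(1)])
        thus "{j. ?F m j \<noteq> 0} \<subseteq> {0..t}" by fastforce
      qed simp
      also have "\<dots> = (\<Sum>j. ?F m (j - int m))"
        using Sum_any_shift[of "?F m" "- int m"] by simp
      also have "\<dots> = (\<Sum>j\<in>{0..t}. ?F m (j - int m))"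
      proof (rule Sum_any.expand_superset)
        have "?F m (j - int m) = 0" if "\<not> (0 \<le> j \<and> j \<le> t)" for j
          using that by (cases "j < 0") (auto simp: exp_coeff_neg lin_0[OF linA] lin_0[OF lin(1)])
        thus "{j. ?F m (j - int m) \<noteq> 0} \<subseteq> {0..t}" by fastforce
      qed simp
      finally show ?thesis .
    qed
    have "scale (of_int t) ?S = (\<Sum>j\<in>{0..t}. scale (x powi (t - j)) (scale (of_int (t - j)) (?A (t - j) (?B j v)))
        + scale (x powi (t - j)) (?A (t - j) (scale (of_int j) (?B j v))))"
      unfolding scale_sum_right lin_scale[OF linA] scale_scale scale_left_distrib[symmetric]
      by (intro sum.cong refl) (simp add: algebra_simps)
    also have "\<dots> = (\<Sum>j\<in>{0..t}. \<Sum>m\<le>N. ?F m j - ?F m (j - int m))"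
    proof (rule sum.cong[OF refl])
      fix j assume j: "j \<in> {0..t}"
      have 1: "scale (of_int (t - j)) (?A (t - j) (?B j v)) = (\<Sum>m\<le>N. ?s m (a m (?A (t - j - int m) (?B j v))))"
        by (rule exp_coeff_rec[OF lin(1) comm(1)]) (use j t in auto)
      have 2: "scale (of_int j) (?B j v) = (\<Sum>m\<le>N. ?s m (b m (?B (j - int m) v)))"
        by (rule exp_coeff_rec[OF lin(2) comm(2)]) (use j t in auto)
      have 3: "scale (x powi (t - j)) (?A (t - j) (?s m (b m (?B (j - int m) v)))) = - ?F m (j - int m)" for m
      proof (cases "m = 0")
        case False
        have "x powi (t - (j - int m)) = x powi (t - j) * x powi (int m)"
          using power_int_add[of x "t - j" "int m"] x by (simp add: algebra_simps)
        thus ?thesis using False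
          by (simp add: ba lin_scale[OF linA] lin_neg[OF linA] aA algebra_simps del: power_int_of_nat)
      qed (simp add: lin_0[OF linA])
      show "scale (x powi (t - j)) (scale (of_int (t - j)) (?A (t - j) (?B j v)))
        + scale (x powi (t - j)) (?A (t - j) (scale (of_int j) (?B j v))) = (\<Sum>m\<le>N. ?F m j - ?F m (j - int m))"
        unfolding 1 2 lin_sum[OF linA] scale_sum_right 3 sum.distrib[symmetric]
        by (intro sum.cong refl) simp
    qed
    also have "\<dots> = (\<Sum>m\<le>N. (\<Sum>j\<in>{0..t}. ?F m j) - (\<Sum>j\<in>{0..t}. ?F m (j - int m)))"
      unfolding sum_subtractf by (subst (1 3) sum.swap) (rule refl)
    also have "\<dots> = 0"
      by (intro sum.neutral ballI) (simp only: right_minus_eq shifted)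
    finally show ?thesis unfolding S using 3 by simp
  next
    case 2
    show ?thesis unfolding S by (simp add: 2 exp_coeff_0)
  qed (simp_all add: S)
qed

end

section \<open>Creation, annihilation and normally ordered products\<close>

sublocale heisenberg_module \<subseteq> complex_vector_space scale ..

context heisenberg_module
begin

text \<open>The scalar \<open>[h\<^bsub>i,n\<^esub>, h\<^bsub>j,-n\<^esub>]\<close>.\<close>

definition bracket :: "nat \<Rightarrow> nat \<Rightarrow> int \<Rightarrow> complex" where
  "bracket i j n = (if i = j then of_int n else - of_int n * struct_coeff q d n)"

lemma h_h:
  assumes "i \<in> {1, 2}" "j \<in> {1, 2}"
  shows "h i n (h j m v) = h j m (h i n v) + scale (if n + m = 0 then bracket i j n else 0) v"
proof (cases "i = j")
  case True
  thus ?thesis using h_h_same[of i n m v] assms by (simp add: bracket_def algebra_simps split: if_splits)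
next
  case False
  thus ?thesis using h_h_diff[of i j n m v] assms by (simp add: bracket_def algebra_simps split: if_splits)
qed

definition cre :: "nat \<Rightarrow> (int \<Rightarrow> complex) \<Rightarrow> int \<Rightarrow> 'v \<Rightarrow> 'v" where
  "cre i c = exp_coeff (\<lambda>n v. scale (c (- int n)) (h i (- int n) v))"

text \<open>The coefficient of \<open>z\<close> to the power \<open>- k\<close>, so that creation and annihilation parts both vanish for \<open>k < 0\<close>.\<close>

definition ann :: "nat \<Rightarrow> (int \<Rightarrow> complex) \<Rightarrow> int \<Rightarrow> 'v \<Rightarrow> 'v" where
  "ann i c = exp_coeff (\<lambda>n v. scale (c (int n)) (h i (int n) v))"

lemma lin_mode: "i \<in> {1, 2} \<Longrightarrow> lin (\<lambda>v. scale c (h i n v))"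
  by (rule lin_comp[OF lin_scale_op linear_h])

lemma lin_cre: "i \<in> {1, 2} \<Longrightarrow> lin (cre i c k)"
  and lin_ann: "i \<in> {1, 2} \<Longrightarrow> lin (ann i c k)"
  unfolding cre_def ann_def by (intro lin_exp_coeff lin_mode; assumption)+

lemma cre_neg: "k < 0 \<Longrightarrow> cre i c k v = 0"
  and ann_neg: "k < 0 \<Longrightarrow> ann i c k v = 0"
  by (simp_all add: cre_def ann_def exp_coeff_neg)

lemma cre_modes_commute:
  assumes "i \<in> {1, 2}" "j \<in> {1, 2}"
  shows "scale c (h i (- int m) (scale c' (h j (- int n) v))) = scale c' (h j (- int n) (scale c (h i (- int m) v)))"
  using h_h[OF assms, of "- int m" "- int n" v] assms
  by (cases "m = 0 \<and> n = 0") (auto simp: h_scale bracket_def mult.commute)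

lemma ann_modes_commute:
  assumes "i \<in> {1, 2}" "j \<in> {1, 2}"
  shows "scale c (h i (int m) (scale c' (h j (int n) v))) = scale c' (h j (int n) (scale c (h i (int m) v)))"
  using h_h[OF assms, of "int m" "int n" v] assms
  by (cases "m = 0 \<and> n = 0") (auto simp: h_scale bracket_def mult.commute)

lemma cre_commute:
  assumes i: "i \<in> {1, 2}" and D: "lin D" "\<And>n v. n < 0 \<Longrightarrow> D (h i n v) = h i n (D v)"
  shows "D (cre i c k v) = cre i c k (D v)"
  unfolding cre_def
  by (rule exp_coeff_commute) (use assms in \<open>auto simp: lin_scale[OF D(1)] intro!: lin_mode cre_modes_commute\<close>)

lemma ann_commute:
  assumes i: "i \<in> {1, 2}" and D: "lin D" "\<And>n v. n > 0 \<Longrightarrow> D (h i n v) = h i n (D v)"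
  shows "D (ann i c k v) = ann i c k (D v)"
  unfolding ann_def
  by (rule exp_coeff_commute) (use assms in \<open>auto simp: lin_scale[OF D(1)] intro!: lin_mode ann_modes_commute\<close>)

lemma cre_cre:
  assumes "i \<in> {1, 2}" "j \<in> {1, 2}"
  shows "cre i c k (cre j c' l v) = cre j c' l (cre i c k v)"
proof (rule cre_commute)
  show "cre i c k (h j n v) = h j n (cre i c k v)" if "n < 0" for n v
    by (rule sym, rule cre_commute) (use assms that h_h[OF assms(2,1), of n] in \<open>auto simp: bracket_def intro: linear_h\<close>)
qed (use assms lin_cre in auto)

lemma ann_ann:
  assumes "i \<in> {1, 2}" "j \<in> {1, 2}"
  shows "ann i c k (ann j c' l v) = ann j c' l (ann i c k v)"
proof (rule ann_commute)
  show "ann i c k (h j n v) = h j n (ann i c k v)" if "n > 0" for n v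
    by (rule sym, rule ann_commute) (use assms that h_h[OF assms(2,1), of n] in \<open>auto simp: bracket_def intro: linear_h\<close>)
qed (use assms lin_ann in auto)

text \<open>The commutator of the annihilation part of the first exponent with the creation part of the second one, as a series in \<open>w / z\<close>.\<close>

definition contraction :: "nat \<Rightarrow> (int \<Rightarrow> complex) \<Rightarrow> nat \<Rightarrow> (int \<Rightarrow> complex) \<Rightarrow> complex fps" where
  "contraction i c j c' =
     Abs_fps (\<lambda>n. if n = 0 then 0 else c (int n) * c' (- int n) * bracket i j (int n))"

lemma ann_cre:
  assumes "i \<in> {1, 2}" "j \<in> {1, 2}"
  shows "ann i c k (cre j c' n v)
    = (\<Sum>r. scale (fps_nth (fps_exp_of (contraction i c j c')) r) (cre j c' (n - int r) (ann i c (k - int r) v)))"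
    (is "_ = (\<Sum>r. ?f r)")
proof -
  have "ann i c k (cre j c' n v) = (\<Sum>r\<le>nat k. ?f r)"
    unfolding ann_def cre_def
  proof (rule exp_coeff_weyl[where \<kappa> = "\<lambda>n. c (int n) * c' (- int n) * bracket i j (int n)"])
    fix m n v assume "m > (0::nat)"
    show "scale (c (int m)) (h i (int m) (scale (c' (- int n)) (h j (- int n) v))) =
       scale (c' (- int n)) (h j (- int n) (scale (c (int m)) (h i (int m) v))) +
       (if n = m then scale (c (int m) * c' (- int m) * bracket i j (int m)) v else 0)"
      using h_h[OF assms, of "int m" "- int n" v] assms
      by (auto simp: h_scale mult.commute scale_right_distrib algebra_simps)
  qed (use assms in \<open>auto simp: contraction_def intro!: lin_mode ann_modes_commute cre_modes_commute\<close>)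
  also have "\<dots> = (\<Sum>r. ?f r)"
  proof (rule Sum_any.expand_superset[symmetric])
    have "?f r = 0" if "r > nat k" for r
      using that by (simp add: ann_def exp_coeff_neg lin_0[OF lin_cre[OF assms(2)]])
    thus "{r. ?f r \<noteq> 0} \<subseteq> {..nat k}" by (auto simp: not_less intro!: leI)
  qed simp
  finally show ?thesis .
qed

lemma finite_ann:
  assumes "i \<in> {1, 2}"
  shows "finite {k. ann i c k v \<noteq> 0}"
proof -
  obtain N where N: "\<And>n. n > N \<Longrightarrow> ser_exp scale (\<lambda>n v. scale (c (int n)) (h i (int n) v)) n v = 0"
    using ser_exp_annihilation[OF assms, of "\<lambda>n. c (int n)" v] by blast
  have "ann i c k v = 0" if "\<not> (0 \<le> k \<and> k \<le> int N)" for k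
    using that N[of "nat k"] by (cases "k < 0") (auto simp: ann_neg, simp add: ann_def exp_coeff_def)
  hence "{k. ann i c k v \<noteq> 0} \<subseteq> {0..int N}" by fastforce
  thus ?thesis by (rule finite_subset) simp
qed

text \<open>
  Only finitely many terms of a product of two exponentials see a given vector after all annihilation modes have been
  moved to the right. This makes the double sums over powers of annihilation modes finite.
\<close>

lemma finite_ann_ann:
  assumes "i \<in> {1, 2}" "j \<in> {1, 2}"
  shows "finite {(k, l). ann i c k (ann j c' l v) \<noteq> 0}"
proof (rule finite_subset)
  show "{(k, l). ann i c k (ann j c' l v) \<noteq> 0} \<subseteq>
    prod.swap ` (SIGMA l:{l. ann j c' l v \<noteq> 0}. {k. ann i c k (ann j c' l v) \<noteq> 0})"
    using lin_0[OF lin_ann[OF assms(1)]] by force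
qed (use finite_ann assms in blast)

abbreviation nexp :: "nat \<Rightarrow> (int \<Rightarrow> complex) \<Rightarrow> int \<Rightarrow> 'v \<Rightarrow> 'v" where
  "nexp i c \<equiv> normal_exp scale c (h i)"

lemma nexp_eq: "nexp i c n v = (\<Sum>k. cre i c (n + k) (ann i c k v))"
proof -
  have "nexp i c n v = (\<Sum>k. cre i c (n - k) (ann i c (- k) v))"
    unfolding normal_exp_def ser_mult_def cre_def ann_def exp_coeff_def by (rule Sum_any.cong) simp
  also have "\<dots> = (\<Sum>k. cre i c (n + k) (ann i c k v))"
    using Sum_any_reflect[of "\<lambda>k. cre i c (n + k) (ann i c k v)" 0] by simp
  finally show ?thesis .
qed

lemma finite_cre_ann:
  assumes "i \<in> {1, 2}" "j \<in> {1, 2}"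
  shows "finite {k. cre i c (g k) (ann j c' k v) \<noteq> 0}"
  by (rule finite_subset[OF _ finite_ann[OF assms(2), of c' v]]) (auto simp: lin_0[OF lin_cre[OF assms(1)]])

lemma lin_nexp:
  assumes "i \<in> {1, 2}"
  shows "lin (nexp i c n)"
proof -
  have "lin (\<lambda>v. \<Sum>k. cre i c (n + k) (ann i c k v))"
    by (intro lin_Sum_anyI lin_comp[OF lin_cre lin_ann] finite_cre_ann assms)
  thus ?thesis by (simp add: nexp_eq[abs_def])
qed

lemma nexp_commute:
  assumes i: "i \<in> {1, 2}" and D: "lin D" "\<And>n v. n \<noteq> 0 \<Longrightarrow> D (h i n v) = h i n (D v)"
  shows "D (nexp i c n v) = nexp i c n (D v)"
  unfolding nexp_eq
  by (subst lin_Sum_any[OF D(1) finite_cre_ann[OF i i]], rule Sum_any.cong)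
    (simp add: cre_commute[OF i D] ann_commute[OF i D])

text \<open>The coefficient of \<open>z\<^sup>a w\<^sup>b\<close> in the normally ordered product of the exponentials at \<open>z\<close> and \<open>w\<close>.\<close>

definition nprod :: "nat \<Rightarrow> (int \<Rightarrow> complex) \<Rightarrow> nat \<Rightarrow> (int \<Rightarrow> complex) \<Rightarrow> int \<Rightarrow> int \<Rightarrow> 'v \<Rightarrow> 'v" where
  "nprod i c j c' a b v = (\<Sum>(k, l). cre i c (a + k) (cre j c' (b + l) (ann i c k (ann j c' l v))))"

text \<open>
  Creation modes commute with each other, and so do annihilation modes. This is what makes the two orders of a product of
  currents comparable.
\<close>

lemma nprod_swap:
  assumes "i \<in> {1, 2}" "j \<in> {1, 2}"
  shows "nprod i c j c' a b v = nprod j c' i c b a v"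
  unfolding nprod_def
proof (rule Sum_any.reindex_cong[where l = prod.swap])
  show "bij (prod.swap :: int \<times> int \<Rightarrow> _)" by (rule bij_swap)
qed (simp add: fun_eq_iff cre_cre[OF assms] ann_ann[OF assms])

lemma finite_nprod_terms:
  assumes "i \<in> {1, 2}" "j \<in> {1, 2}"
  shows "finite {(r, k, l). cre i c (a + r + k) (cre j c' (b - r + l) (ann i c k (ann j c' l v))) \<noteq> 0}"
proof (rule finite_subset)
  let ?S = "{(k, l). ann i c k (ann j c' l v) \<noteq> 0}"
  show "{(r, k, l). cre i c (a + r + k) (cre j c' (b - r + l) (ann i c k (ann j c' l v))) \<noteq> 0}
     \<subseteq> prod.swap ` (SIGMA p:?S. {- a - fst p..b + snd p})"
  proof clarify
    fix r k l assume *: "cre i c (a + r + k) (cre j c' (b - r + l) (ann i c k (ann j c' l v))) \<noteq> 0"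
    have "(k, l) \<in> ?S" using * lin_0[OF lin_cre[OF assms(1)]] lin_0[OF lin_cre[OF assms(2)]] by auto
    moreover have "r \<ge> - a - k" using * cre_neg[of "a + r + k"] by fastforce
    moreover have "r \<le> b + l" using * cre_neg[of "b - r + l"] lin_0[OF lin_cre[OF assms(1)]] by fastforce
    ultimately show "(r, k, l) \<in> prod.swap ` (SIGMA p:?S. {- a - fst p..b + snd p})" by force
  qed
  show "finite (prod.swap ` (SIGMA p:?S. {- a - fst p..b + snd p}))"
    using finite_ann_ann[OF assms, of c c' v] by blast
qed

lemma finite_nprod_antidiagonal:
  assumes "i \<in> {1, 2}" "j \<in> {1, 2}"
  shows "finite {r. nprod i c j c' (a + r) (b - r) v \<noteq> 0}"
  unfolding nprod_def
  by (rule finite_Sum_any_support, rule finite_subset[OF _ finite_nprod_terms[OF assms, of c a c' b v]]) auto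

text \<open>
  Wick's formula for two exponentials: only the annihilation part of the first factor and the creation part of the second one
  are in the wrong order, and exchanging them costs the exponential of the contraction.
\<close>

lemma nexp_nexp:
  assumes ij: "i \<in> {1, 2}" "j \<in> {1, 2}"
  shows "nexp i c a (nexp j c' b v)
    = (\<Sum>r. scale (fps_nth (fps_exp_of (contraction i c j c')) r) (nprod i c j c' (a + int r) (b - int r) v))"
proof -
  let ?g = "fps_nth (fps_exp_of (contraction i c j c'))"
  define T where "T = (\<lambda>k l r. scale (?g r)
    (cre i c (a + k) (cre j c' (b + l - int r) (ann i c (k - int r) (ann j c' l v)))))"
  note cre_0 = lin_0[OF lin_cre[OF ij(1)]] lin_0[OF lin_cre[OF ij(2)]]
  let ?S = "{(k, l). ann i c k (ann j c' l v) \<noteq> 0}"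
  have fin: "finite {(k, l, r). T k l r \<noteq> 0}"
  proof (rule finite_subset)
    show "{(k, l, r). T k l r \<noteq> 0} \<subseteq>
      (\<lambda>((k, l), r). (k + int r, l, r)) ` (SIGMA p:?S. {..nat (b + snd p)})"
    proof clarify
      fix k l r assume *: "T k l r \<noteq> 0"
      have "(k - int r, l) \<in> ?S" using * cre_0 by (auto simp: T_def add.commute)
      moreover have "r \<le> nat (b + l)"
        using * cre_neg[of "b + l - int r"] cre_0 by (fastforce simp: T_def)
      ultimately show "(k, l, r) \<in> (\<lambda>((k, l), r). (k + int r, l, r)) ` (SIGMA p:?S. {..nat (b + snd p)})"
        by (intro image_eqI[where x = "((k - int r, l), r)"]) auto
    qed
    show "finite ((\<lambda>((k, l), r). (k + int r, l, r)) ` (SIGMA p:?S. {..nat (b + snd p)}))"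
      using finite_ann_ann[OF ij, of c c' v] by blast
  qed
  have fin_lr: "finite {(l, r). T k l r \<noteq> 0}" for k
    by (rule finite_subset[OF _ finite_imageI[OF fin, of snd]]) force
  have fin_kr: "finite {(k, r). (\<Sum>l. T k l r) \<noteq> 0}"
    by (rule finite_subset[OF _ finite_imageI[OF fin, of "\<lambda>(k, l, r). (k, r)"]])
      (force elim: Sum_any.not_neutral_obtains_not_neutral)
  have "nexp i c a (nexp j c' b v)
      = (\<Sum>k. cre i c (a + k) (ann i c k (\<Sum>l. cre j c' (b + l) (ann j c' l v))))"
    by (simp only: nexp_eq)
  also have "\<dots> = (\<Sum>k. \<Sum>l. cre i c (a + k) (ann i c k (cre j c' (b + l) (ann j c' l v))))"
    by (rule Sum_any.cong)
      (rule lin_Sum_any[OF lin_comp[OF lin_cre lin_ann] finite_cre_ann], fact+)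
  also have "\<dots> = (\<Sum>k. \<Sum>l. \<Sum>r. T k l r)"
  proof (intro Sum_any.cong)
    fix k l
    let ?f = "\<lambda>r. scale (?g r) (cre j c' (b + l - int r) (ann i c (k - int r) (ann j c' l v)))"
    have "?f r = 0" if "r > nat k" for r
      using that by (simp add: ann_neg cre_0)
    hence "{r. ?f r \<noteq> 0} \<subseteq> {..nat k}" by (auto intro!: leI)
    hence "finite {r. ?f r \<noteq> 0}" by (rule finite_subset) simp
    thus "cre i c (a + k) (ann i c k (cre j c' (b + l) (ann j c' l v))) = (\<Sum>r. T k l r)"
      unfolding ann_cre[OF ij] T_def
      by (subst lin_Sum_any[OF lin_cre[OF ij(1)]]) (simp_all add: lin_scale[OF lin_cre[OF ij(1)]])
  qed
  also have "\<dots> = (\<Sum>k. \<Sum>r. \<Sum>l. T k l r)"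
    by (intro Sum_any.cong Sum_any_swap fin_lr)
  also have "\<dots> = (\<Sum>r. \<Sum>k. \<Sum>l. T k l r)"
    by (intro Sum_any_swap fin_kr)
  also have "\<dots> = (\<Sum>r. scale (?g r) (nprod i c j c' (a + int r) (b - int r) v))"
  proof (rule Sum_any.cong)
    fix r
    let ?t = "\<lambda>k l. cre i c (a + int r + k) (cre j c' (b - int r + l) (ann i c k (ann j c' l v)))"
    have fin_t: "finite {(k, l). ?t k l \<noteq> 0}"
      by (rule finite_subset[OF _ finite_ann_ann[OF ij, of c c' v]]) (auto simp: cre_0)
    \<comment> \<open>In the term of index \<open>r\<close> the index of the first annihilation part is lowered by \<open>r\<close>; shifting \<open>k\<close> back
      leaves a power of \<open>w / z\<close>.\<close>
    have "(\<Sum>k. \<Sum>l. T k l r) = (\<Sum>k. \<Sum>l. T (k + int r) l r)"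
      by (rule Sum_any_shift[symmetric])
    also have "\<dots> = (\<Sum>k. \<Sum>l. scale (?g r) (?t k l))"
      by (simp add: T_def algebra_simps)
    also have "\<dots> = (\<Sum>(k, l). scale (?g r) (?t k l))"
      by (rule Sum_any_pair, rule finite_subset[OF _ fin_t]) auto
    also have "\<dots> = scale (?g r) (\<Sum>(k, l). ?t k l)"
      by (subst scale_Sum_any) (use fin_t in \<open>simp_all add: case_prod_unfold\<close>)
    finally show "(\<Sum>k. \<Sum>l. T k l r) = scale (?g r) (nprod i c j c' (a + int r) (b - int r) v)"
      by (simp add: nprod_def)
  qed
  finally show ?thesis .
qed

text \<open>
  The hypothesis on \<open>c'\<close> says that the exponent at \<open>w\<close> is the negative of the exponent at \<open>z = x w\<close>. On the line
  \<open>z = x w\<close>, the creation parts and the annihilation parts then cancel separately.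
\<close>

lemma nprod_cancel:
  assumes i: "i \<in> {1, 2}" and x: "x \<noteq> 0" and c': "\<And>n. n \<noteq> 0 \<Longrightarrow> c' n = - (c n * x powi (- n))"
  shows "(\<Sum>b. scale (x powi (s - b)) (nprod i c i c' (s - b) b v)) = (if s = 0 then v else 0)"
proof -
  note lin_cre = lin_cre[OF i] and lin_ann = lin_ann[OF i]
  have cre_cancel: "(\<Sum>j. scale (x powi (t - j)) (cre i c (t - j) (cre i c' j u))) = (if t = 0 then u else 0)" for t u
    unfolding cre_def
    by (rule exp_coeff_cancel)
      (use i x in \<open>auto simp: c' mult.commute intro!: lin_mode cre_modes_commute simp del: power_int_of_nat\<close>)
  have ann_cancel: "(\<Sum>j. scale (inverse x powi (t - j)) (ann i c (t - j) (ann i c' j u))) = (if t = 0 then u else 0)" for t u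
    unfolding ann_def
    by (rule exp_coeff_cancel)
      (use i x in \<open>auto simp: c' mult.commute power_int_minus power_int_inverse simp del: power_int_of_nat
         intro!: lin_mode ann_modes_commute\<close>)
  define T where "T = (\<lambda>b (k, l). scale (x powi (s - b)) (cre i c (s - b + k) (cre i c' (b + l) (ann i c k (ann i c' l v)))))"
  have fin: "finite {(b, p). T b p \<noteq> 0}"
  proof (rule finite_subset)
    show "{(b, p). T b p \<noteq> 0} \<subseteq> (\<lambda>(r, k, l). (- r, k, l)) `
      {(r, k, l). cre i c (s + r + k) (cre i c' (0 - r + l) (ann i c k (ann i c' l v))) \<noteq> 0}"
    proof clarify
      fix b k l assume "T b (k, l) \<noteq> 0"
      thus "(b, k, l) \<in> (\<lambda>(r, k, l). (- r, k, l)) `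
        {(r, k, l). cre i c (s + r + k) (cre i c' (0 - r + l) (ann i c k (ann i c' l v))) \<noteq> 0}"
        by (intro image_eqI[where x = "(- b, k, l)"]) (auto simp: T_def add.commute)
    qed
  qed (intro finite_imageI finite_nprod_terms i)
  have "(\<Sum>b. scale (x powi (s - b)) (nprod i c i c' (s - b) b v)) = (\<Sum>b. \<Sum>p. T b p)"
  proof (rule Sum_any.cong)
    fix b
    have "finite {p. (case p of (k, l) \<Rightarrow> cre i c (s - b + k) (cre i c' (b + l) (ann i c k (ann i c' l v)))) \<noteq> 0}"
      by (rule finite_subset[OF _ finite_ann_ann[OF i i, of c c' v]]) (auto simp: lin_0[OF lin_cre])
    thus "scale (x powi (s - b)) (nprod i c i c' (s - b) b v) = (\<Sum>p. T b p)"
      unfolding nprod_def T_def by (subst scale_Sum_any) (simp_all add: case_prod_unfold)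
  qed
  also have "\<dots> = (\<Sum>p. \<Sum>b. T b p)"
    by (rule Sum_any_swap[OF fin])
  also have "\<dots> = (\<Sum>(k, l). if s + k + l = 0 then scale (inverse x powi k) (ann i c k (ann i c' l v)) else 0)"
  proof (rule Sum_any.cong, clarify)
    fix k l
    let ?u = "ann i c k (ann i c' l v)" and ?t = "s + k + l"
    let ?f = "\<lambda>j. scale (x powi (?t - j)) (cre i c (?t - j) (cre i c' j ?u))"
    \<comment> \<open>With \<open>j = b + l\<close> the powers of \<open>x\<close> split into \<open>x\<^bsup>-k\<^esup>\<close> and those in \<open>cre_cancel\<close>.\<close>
    have "(\<Sum>b. T b (k, l)) = (\<Sum>b. scale (inverse x powi k) (?f (b + l)))"
      using x by (intro Sum_any.cong)
        (simp add: T_def power_int_add power_int_diff power_int_inverse algebra_simps)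
    also have "\<dots> = (\<Sum>j. scale (inverse x powi k) (?f j))"
      by (rule Sum_any_shift)
    also have "\<dots> = scale (inverse x powi k) (\<Sum>j. ?f j)"
    proof (rule scale_Sum_any[symmetric])
      have "?f j = 0" if "\<not> (0 \<le> j \<and> j \<le> ?t)" for j
        using that by (cases "j < 0") (auto simp: cre_neg lin_0[OF lin_cre])
      hence "{j. ?f j \<noteq> 0} \<subseteq> {0..?t}" by fastforce
      thus "finite {j. ?f j \<noteq> 0}" by (rule finite_subset) simp
    qed
    finally show "(\<Sum>b. T b (k, l)) = (if ?t = 0 then scale (inverse x powi k) ?u else 0)"
      unfolding cre_cancel by simp
  qed
  also have "\<dots> = (\<Sum>l. \<Sum>k. if s + k + l = 0 then scale (inverse x powi k) (ann i c k (ann i c' l v)) else 0)"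
  proof -
    let ?F = "\<lambda>k l. if s + k + l = 0 then scale (inverse x powi k) (ann i c k (ann i c' l v)) else 0"
    have fin: "finite {(k, l). ?F k l \<noteq> 0}"
      by (rule finite_subset[OF _ finite_ann_ann[OF i i, of c c' v]]) auto
    show ?thesis using Sum_any_pair[OF fin] Sum_any_swap[OF fin] by simp
  qed
  also have "\<dots> = (\<Sum>l. scale (inverse x powi (- s - l)) (ann i c (- s - l) (ann i c' l v)))"
  proof (rule Sum_any.cong)
    fix l
    have "(s + k + l = 0) = (k = - s - l)" for k by auto
    thus "(\<Sum>k. if s + k + l = 0 then scale (inverse x powi k) (ann i c k (ann i c' l v)) else 0)
      = scale (inverse x powi (- s - l)) (ann i c (- s - l) (ann i c' l v))"
      by (simp only: Sum_any.delta)
  qed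
  finally show ?thesis unfolding ann_cancel by simp
qed

end

section \<open>Zero modes\<close>

context heisenberg_module
begin

lemma op_fun_commute:
  assumes T: "lin T" "span {v. \<exists>x. T v = scale x v} = UNIV" and X: "lin X" "\<And>v. X (T v) = T (X v)"
  shows "op_fun scale \<phi> T (X v) = X (op_fun scale \<phi> T v)"
proof (rule lin_eq_on_span[where F = "\<lambda>v. op_fun scale \<phi> T (X v)", OF _ _ T(2)])
  show "op_fun scale \<phi> T (X v) = X (op_fun scale \<phi> T v)" if v: "v \<in> {v. \<exists>x. T v = scale x v}" for v
  proof -
    obtain x where x: "T v = scale x v" using v by blast
    have "T (X v) = scale x (X v)" using X x by (metis lin_scale)
    thus ?thesis using x op_fun_eigenvector[OF T, of _ x] by (simp add: lin_scale[OF X(1)])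
  qed
  show "lin (\<lambda>v. op_fun scale \<phi> T (X v))" "lin (\<lambda>v. X (op_fun scale \<phi> T v))"
    using lin_comp[OF linear_op_fun[OF T] X(1)] lin_comp[OF X(1) linear_op_fun[OF T]] .
qed

lemma op_fun_inverse:
  assumes T: "lin T" "span {v. \<exists>x. T v = scale x v} = UNIV" and "\<And>x. \<phi> x * \<psi> x = 1"
  shows "op_fun scale \<phi> T (op_fun scale \<psi> T v) = v"
proof (rule lin_eq_on_span[OF _ _ T(2)])
  show "op_fun scale \<phi> T (op_fun scale \<psi> T v) = v" if v: "v \<in> {v. \<exists>x. T v = scale x v}" for v
  proof -
    obtain x where x: "T v = scale x v" using v by blast
    show ?thesis
      by (simp add: op_fun_eigenvector[OF T x] lin_scale[OF linear_op_fun[OF T]] mult.commute assms(3))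
  qed
  show "lin (\<lambda>v. v)" by (rule linI) auto
  show "lin (\<lambda>v. op_fun scale \<phi> T (op_fun scale \<psi> T v))"
    using lin_comp[OF linear_op_fun[OF T] linear_op_fun[OF T]] .
qed

definition q1_power :: "complex \<Rightarrow> int \<Rightarrow> 'v \<Rightarrow> 'v" where
  "q1_power l1 \<epsilon> = op_fun scale (\<lambda>x. exp (of_int \<epsilon> * l1 * x)) a0"

text \<open>The operator \<open>e\<close> to the \<open>\<epsilon> Q\<^sub>i\<close>; the sign \<open>\<epsilon>\<close> ranges over \<open>1\<close> and \<open>- 1\<close> here and below.\<close>

definition eQ_power :: "int \<Rightarrow> nat \<Rightarrow> 'v \<Rightarrow> 'v" where
  "eQ_power \<epsilon> i = (if \<epsilon> = 1 then eQ i else inv (eQ i))"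

text \<open>The coefficient of \<open>h\<^bsub>i,n\<^esub> z\<^bsup>-n\<^esup>\<close> in the exponent of \<open>\<Lambda>\<^sup>\<epsilon>\<^sub>i(z)\<close>.\<close>

definition vcoeff :: "int \<Rightarrow> int \<Rightarrow> complex" where
  "vcoeff \<epsilon> n = - (of_int \<epsilon> * q powi (\<epsilon> * n) / of_int n)"

text \<open>The commutator of \<open>h\<^bsub>i,0\<^esub>\<close> with \<open>Q\<^sub>j\<close>; by \<open>h\<^bsub>1,0\<^esub> = - h\<^bsub>2,0\<^esub>\<close> it is also the ratio of \<open>h\<^bsub>j,0\<^esub>\<close> and \<open>h\<^bsub>i,0\<^esub>\<close>.\<close>

definition pairing :: "nat \<Rightarrow> nat \<Rightarrow> int" where
  "pairing i j = (if i = j then 1 else - 1)"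

text \<open>Treating both halves of the current uniformly in the sign reduces the number of cases in the relations.\<close>

definition Lam :: "complex \<Rightarrow> int \<Rightarrow> nat \<Rightarrow> int \<Rightarrow> 'v \<Rightarrow> 'v" where
  "Lam l1 \<epsilon> i = (if \<epsilon> = 1 then Lambda_plus scale q l1 h a0 eQ i else Lambda_minus scale q l1 h a0 eQ i)"

lemma lin_q1_power: "lin (q1_power l1 \<epsilon>)"
  unfolding q1_power_def by (rule linear_op_fun[OF linear_a0 diag_a0])

lemma q1_power_commute: "lin X \<Longrightarrow> (\<And>v. X (a0 v) = a0 (X v)) \<Longrightarrow> q1_power l1 \<epsilon> (X v) = X (q1_power l1 \<epsilon> v)"
  unfolding q1_power_def by (rule op_fun_commute[OF linear_a0 diag_a0])

lemma q1_power_inverse: "q1_power l1 \<epsilon> (q1_power l1 (- \<epsilon>) v) = v"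
  unfolding q1_power_def by (rule op_fun_inverse[OF linear_a0 diag_a0]) (simp flip: exp_add)

lemma q1_power_a0: "q1_power l1 \<epsilon> (a0 v) = a0 (q1_power l1 \<epsilon> v)"
  by (rule q1_power_commute) (rule linear_a0, rule refl)

lemma q1_power_q1_power: "q1_power l1 \<epsilon> (q1_power l1 \<eta> v) = q1_power l1 \<eta> (q1_power l1 \<epsilon> v)"
  by (rule q1_power_commute[OF lin_q1_power q1_power_a0])

lemma q1_power_h: "i \<in> {1, 2} \<Longrightarrow> q1_power l1 \<epsilon> (h i n v) = h i n (q1_power l1 \<epsilon> v)"
  by (rule q1_power_commute) (auto simp: linear_h h_a0)

lemma inv_eQ:
  assumes "i \<in> {1, 2}"
  shows "inv (eQ i) (eQ i v) = v" "eQ i (inv (eQ i) v) = v"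
  using bij_eQ[OF assms] by (simp_all add: bij_is_inj bij_is_surj surj_f_inv_f)

lemma lin_eQ_power: "i \<in> {1, 2} \<Longrightarrow> lin (eQ_power \<epsilon> i)"
  unfolding eQ_power_def using linear_eQ lin_inv[OF linear_eQ bij_eQ] by auto

text \<open>A commutation relation with \<open>e\<close> to the \<open>Q\<^sub>j\<close> passes to the inverse with the opposite sign of the constant.\<close>

lemma eQ_power_intertwine:
  assumes "j \<in> {1, 2}" "\<epsilon> \<in> {1, - 1}" "lin X" "\<And>v. X (eQ j v) = eQ j (X v + scale c v)"
  shows "X (eQ_power \<epsilon> j v) = eQ_power \<epsilon> j (X v + scale (of_int \<epsilon> * c) v)"
proof (cases "\<epsilon> = 1")
  case False
  define w where "w = inv (eQ j) v"
  have v: "v = eQ j w" by (simp add: w_def inv_eQ[OF assms(1)])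
  have "eQ j (X w) = X v - scale c v"
    using assms(4)[of w] by (simp add: v lin_add lin_scale linear_eQ[OF assms(1)])
  hence "X w = inv (eQ j) (X v - scale c v)" by (metis inv_eQ(1)[OF assms(1)])
  thus ?thesis using False assms(2) by (simp add: eQ_power_def w_def)
qed (use assms in \<open>simp add: eQ_power_def\<close>)

lemma a0_eQ_power: "j \<in> {1, 2} \<Longrightarrow> \<epsilon> \<in> {1, - 1} \<Longrightarrow> a0 (eQ_power \<epsilon> j v) = eQ_power \<epsilon> j (a0 v)"
  using eQ_power_intertwine[of j \<epsilon> a0 0 v, OF _ _ linear_a0] a0_eQ by simp

lemma h_eQ_power:
  "i \<in> {1, 2} \<Longrightarrow> j \<in> {1, 2} \<Longrightarrow> \<epsilon> \<in> {1, - 1} \<Longrightarrow> n \<noteq> 0 \<Longrightarrow> h i n (eQ_power \<epsilon> j v) = eQ_power \<epsilon> j (h i n v)"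
  using eQ_power_intertwine[of j \<epsilon> "h i n" 0 v, OF _ _ linear_h] h_eQ by simp

lemma h0_eQ_power:
  assumes "i \<in> {1, 2}" "j \<in> {1, 2}" "\<epsilon> \<in> {1, - 1}"
  shows "h i 0 (eQ_power \<epsilon> j v) = eQ_power \<epsilon> j (h i 0 v + scale (of_int (pairing i j * \<epsilon>)) v)"
proof -
  have "h i 0 (eQ j v) = eQ j (h i 0 v + scale (of_int (pairing i j)) v)" for v
    using h0_eQ_same h0_eQ_diff assms by (cases "i = j") (auto simp: pairing_def)
  from eQ_power_intertwine[OF assms(2,3) linear_h[OF assms(1)] this] show ?thesis
    by (simp add: mult.commute)
qed

lemma q1_power_eQ_power:
  "j \<in> {1, 2} \<Longrightarrow> \<eta> \<in> {1, - 1} \<Longrightarrow> q1_power l1 \<epsilon> (eQ_power \<eta> j v) = eQ_power \<eta> j (q1_power l1 \<epsilon> v)"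
  by (rule q1_power_commute) (auto simp: lin_eQ_power a0_eQ_power)

lemma eQ_2: "eQ 2 = inv (eQ 1)"
  using eQ_1_2 inv_eQ(1)[of 1] by (metis ext insertI1)

lemma eQ_power_eQ_power:
  assumes "i \<in> {1, 2}" "j \<in> {1, 2}"
  shows "eQ_power \<epsilon> i (eQ_power \<eta> j v) = eQ_power \<eta> j (eQ_power \<epsilon> i v)"
proof -
  have "inv (inv (eQ 1)) = eQ 1" by (rule inv_inv_eq[OF bij_eQ]) simp
  hence "eQ_power \<epsilon> i \<in> {eQ 1, inv (eQ 1)}" "eQ_power \<eta> j \<in> {eQ 1, inv (eQ 1)}"
    using assms by (auto simp: eQ_power_def eQ_2)
  thus ?thesis using inv_eQ[of 1] by auto
qed

lemma eQ_power_inverse: "i \<in> {1, 2} \<Longrightarrow> eQ_power 1 i (eQ_power (- 1) i v) = v"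
  using inv_eQ(2) by (simp add: eQ_power_def)

lemma nexp_eQ_power:
  "i \<in> {1, 2} \<Longrightarrow> j \<in> {1, 2} \<Longrightarrow> \<epsilon> \<in> {1, - 1} \<Longrightarrow> eQ_power \<epsilon> j (nexp i c n v) = nexp i c n (eQ_power \<epsilon> j v)"
  by (rule nexp_commute) (auto simp: lin_eQ_power h_eQ_power)

lemma nexp_q1_power: "i \<in> {1, 2} \<Longrightarrow> q1_power l1 \<epsilon> (nexp i c n v) = nexp i c n (q1_power l1 \<epsilon> v)"
  by (rule nexp_commute) (auto simp: lin_q1_power q1_power_h)

lemma nexp_h0:
  assumes "i \<in> {1, 2}" "j \<in> {1, 2}"
  shows "h j 0 (nexp i c n v) = nexp i c n (h j 0 v)"
  by (rule nexp_commute) (use assms h_h[of j i 0] in \<open>auto simp: linear_h\<close>)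

lemma lin_Lam:
  assumes i: "i \<in> {1, 2}"
  shows "lin (Lam l1 \<epsilon> i n)"
proof -
  have q1: "lin (op_fun scale \<phi> a0)" for \<phi> by (rule linear_op_fun[OF linear_a0 diag_a0])
  have "lin (Lambda_plus scale q l1 h a0 eQ i n)"
    unfolding Lambda_plus_def ser_mult_def
    by (intro lin_Sum_anyI lin_comp[OF lin_nexp[OF i]] lin_comp[OF linear_eQ[OF i]]
        lin_comp[OF linear_z_powr[OF linear_h[OF i] diag_h0'(1)[OF i]]] q1
        ser_mult_normal_exp(1)[OF i] zero_modes_finite(1)[OF i])
  moreover have "lin (Lambda_minus scale q l1 h a0 eQ i n)"
    unfolding Lambda_minus_def ser_mult_def
    by (intro lin_Sum_anyI lin_comp[OF lin_nexp[OF i]] lin_comp[OF lin_inv[OF linear_eQ[OF i] bij_eQ[OF i]]]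
        lin_comp[OF linear_z_powr[OF linear_minus_h[OF i] diag_h0'(2)[OF i]]] q1
        ser_mult_normal_exp(1)[OF i] zero_modes_finite(2)[OF i])
  ultimately show ?thesis by (simp add: Lam_def)
qed

text \<open>
  On an eigenvector only one power of \<open>z\<close> survives in \<open>(q\<^bsup>-\<epsilon>\<^esup> z)\<close> to the \<open>\<epsilon> h\<^bsub>i,0\<^esub>\<close>, and
  \<open>q\<close> to the \<open>- \<epsilon>\<close> raised to the \<open>\<epsilon> N\<close> is \<open>q\<^bsup>-N\<^esup>\<close> for both signs.
\<close>

lemma Lam_eigenvector:
  assumes i: "i \<in> {1, 2}" and \<epsilon>: "\<epsilon> \<in> {1, - 1}" and v: "h i 0 v = scale (of_int N) v"
  shows "Lam l1 \<epsilon> i n v = scale (q powi (- N)) (nexp i (vcoeff \<epsilon>) (n - \<epsilon> * N) (eQ_power \<epsilon> i (q1_power l1 \<epsilon> v)))"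
proof -
  have v': "h i 0 (q1_power l1 \<epsilon> v) = scale (of_int N) (q1_power l1 \<epsilon> v)"
    using v by (simp add: lin_scale[OF lin_q1_power] flip: q1_power_h[OF i])
  have lin: "lin (\<lambda>v. nexp i c n (eQ_power \<epsilon> i v))" for c n
    by (rule lin_comp[OF lin_nexp[OF i] lin_eQ_power[OF i]])
  show ?thesis
  proof (cases "\<epsilon> = 1")
    case True
    have "Lam l1 \<epsilon> i n v = (\<Sum>k. nexp i (vcoeff \<epsilon>) (n - k)
        (eQ_power \<epsilon> i (z_powr scale (inverse q) (h i 0) k (q1_power l1 \<epsilon> v))))"
      unfolding True
      by (simp add: Lam_def Lambda_plus_def ser_mult_def vcoeff_def[abs_def] eQ_power_def q1_power_def)
    also have "\<dots> = (\<Sum>k. if k = N then nexp i (vcoeff \<epsilon>) (n - k) (eQ_power \<epsilon> i (scale (inverse q powi N) (q1_power l1 \<epsilon> v))) else 0)"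
      by (rule Sum_any.cong)
        (simp add: z_powr_eigenvector[OF linear_h[OF i] diag_h0'(1)[OF i] v'] lin_0[OF lin])
    finally show ?thesis
      by (simp add: True lin_scale[OF lin[unfolded True]] power_int_minus power_int_inverse)
  next
    case False
    hence \<epsilon>: "\<epsilon> = - 1" using \<epsilon> by simp
    have v': "- h i 0 (q1_power l1 \<epsilon> v) = scale (of_int (- N)) (q1_power l1 \<epsilon> v)"
      using v' by simp
    have "Lam l1 \<epsilon> i n v = (\<Sum>k. nexp i (vcoeff \<epsilon>) (n - k)
        (eQ_power \<epsilon> i (z_powr scale q (\<lambda>v. - h i 0 v) k (q1_power l1 \<epsilon> v))))"
      unfolding \<epsilon>
      by (simp add: Lam_def Lambda_minus_def ser_mult_def vcoeff_def[abs_def] eQ_power_def q1_power_def)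
    also have "\<dots> = (\<Sum>k. if k = - N then nexp i (vcoeff \<epsilon>) (n - k) (eQ_power \<epsilon> i (scale (q powi (- N)) (q1_power l1 \<epsilon> v))) else 0)"
      by (rule Sum_any.cong)
        (simp add: z_powr_eigenvector[OF linear_minus_h[OF i] diag_h0'(2)[OF i] v'] lin_0[OF lin])
    finally show ?thesis
      by (simp add: \<epsilon> lin_scale[OF lin[unfolded \<epsilon>]])
  qed
qed

lemma pairing_eigenvector:
  assumes "i \<in> {1, 2}" "j \<in> {1, 2}" "h i 0 v = scale (of_int N) v"
  shows "h j 0 v = scale (of_int (pairing i j * N)) v"
proof -
  have "h 2 0 v = - h 1 0 v" using h_1_2[of v] by simp
  moreover have "h 1 0 v = - h 2 0 v" by (rule h_1_2)
  ultimately show ?thesis using assms by (auto simp: pairing_def)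
qed

definition zero_modes :: "complex \<Rightarrow> int \<Rightarrow> nat \<Rightarrow> int \<Rightarrow> nat \<Rightarrow> 'v \<Rightarrow> 'v" where
  "zero_modes l1 \<epsilon> i \<eta> j v = eQ_power \<epsilon> i (q1_power l1 \<epsilon> (eQ_power \<eta> j (q1_power l1 \<eta> v)))"

text \<open>Together with \<open>nprod_swap\<close> this shows that both orders of a product act through the same normally ordered operators.\<close>

lemma zero_modes_swap:
  assumes "i \<in> {1, 2}" "j \<in> {1, 2}" "\<epsilon> \<in> {1, - 1}" "\<eta> \<in> {1, - 1}"
  shows "zero_modes l1 \<epsilon> i \<eta> j v = zero_modes l1 \<eta> j \<epsilon> i v"
  unfolding zero_modes_def
  by (simp only: q1_power_eQ_power assms eQ_power_eQ_power[of i j] q1_power_q1_power[of l1 \<epsilon> \<eta>])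

lemma zero_modes_opposite:
  assumes "i \<in> {1, 2}"
  shows "zero_modes l1 1 i (- 1) i v = v"
  unfolding zero_modes_def using assms q1_power_inverse[of l1 1]
  by (simp add: q1_power_eQ_power eQ_power_inverse)

section \<open>Contractions\<close>

lemma vcoeff_mult:
  assumes "q \<noteq> 0"
  shows "vcoeff \<epsilon> n * vcoeff \<eta> (- n) = - (of_int (\<epsilon> * \<eta>) * (q powi (\<epsilon> - \<eta>)) powi n / of_int n ^ 2)"
proof -
  have "(q powi (\<epsilon> - \<eta>)) powi n = q powi (\<epsilon> * n) * q powi (- (\<eta> * n))"
    using assms by (simp add: left_diff_distrib flip: power_int_mult power_int_add)
  thus ?thesis by (simp add: vcoeff_def power2_eq_square)
qed

lemma contraction_same:
  assumes "q \<noteq> 0"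
  shows "contraction i (vcoeff \<epsilon>) i (vcoeff \<eta>) = fps_const (of_int (\<epsilon> * \<eta>)) * fps_log_one_minus (q powi (\<epsilon> - \<eta>))"
  by (rule fps_ext)
    (simp add: contraction_def vcoeff_mult[OF assms] bracket_def fps_log_one_minus_def power2_eq_square)

definition log_struct :: "complex fps" where
  "log_struct = Abs_fps (\<lambda>n. if n = 0 then 0 else - (struct_coeff q d (int n) / of_nat n))"

lemma struct_fun_eq: "struct_fun q d = fps_exp_of log_struct"
  by (simp add: struct_fun_def log_struct_def)

lemma contraction_diff_nth:
  assumes "q \<noteq> 0" "i \<noteq> j"
  shows "fps_nth (contraction i (vcoeff \<epsilon>) j (vcoeff \<eta>)) n
    = - (of_int (\<epsilon> * \<eta>) * (q powi (\<epsilon> - \<eta>)) ^ n * fps_nth log_struct n)"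
  using assms(2)
  by (simp add: contraction_def vcoeff_mult[OF assms(1)] bracket_def log_struct_def power2_eq_square)

lemma struct_contraction_same_sign:
  assumes "q \<noteq> 0" "i \<noteq> j" "\<epsilon> \<in> {1, - 1}"
  shows "struct_fun q d * fps_exp_of (contraction i (vcoeff \<epsilon>) j (vcoeff \<epsilon>)) = 1"
proof -
  have "log_struct + contraction i (vcoeff \<epsilon>) j (vcoeff \<epsilon>) = 0"
    by (rule fps_ext) (use assms in \<open>auto simp: contraction_diff_nth\<close>)
  hence "fps_exp_of (log_struct + contraction i (vcoeff \<epsilon>) j (vcoeff \<epsilon>)) = 1"
    by simp
  thus ?thesis
    unfolding struct_fun_eq by (subst fps_exp_of_add[symmetric]) (simp_all add: log_struct_def contraction_def)
qed

text \<open>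
  The sum of the exponents has the factor \<open>1 + q\<^sub>2\<^bsup>n\<^esup>\<close> or \<open>1 + q\<^sub>2\<^bsup>-n\<^esup>\<close>, depending on the sign, and this cancels the
  denominator of \<open>struct_coeff\<close> up to a power of \<open>q\<^sub>2\<close>. What is left are logarithms of two linear factors.
\<close>

lemma struct_contraction_opposite_sign:
  assumes "q \<noteq> 0" "i \<noteq> j" "\<epsilon> \<in> {1, - 1}" and generic: "\<And>n. n > 0 \<Longrightarrow> 1 + q2 q powi (- int n) \<noteq> 0"
  shows "struct_fun q d * fps_exp_of (contraction i (vcoeff \<epsilon>) j (vcoeff (- \<epsilon>)))
    = (1 - fps_const (q1 q d * q powi (1 + \<epsilon>)) * fps_X) * (1 - fps_const (q3 q d * q powi (1 + \<epsilon>)) * fps_X)"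
proof -
  let ?c = "contraction i (vcoeff \<epsilon>) j (vcoeff (- \<epsilon>))" and ?t = "q powi (1 + \<epsilon>)"
  have *: "log_struct + ?c = fps_log_one_minus (q1 q d * ?t) + fps_log_one_minus (q3 q d * ?t)"
  proof (rule fps_ext)
    fix n
    show "fps_nth (log_struct + ?c) n = fps_nth (fps_log_one_minus (q1 q d * ?t) + fps_log_one_minus (q3 q d * ?t)) n"
    proof (cases "n = 0")
      case False
      let ?D = "1 + q2 q powi (- int n)"
      have D: "?D \<noteq> 0" using generic False by simp
      have t: "?t ^ n * ?D = 1 + (q powi (2 * \<epsilon>)) ^ n"
        using assms(1,3)
        by (auto simp: q2_def power_int_minus field_simps power_mult_distrib simp flip: power_mult)
      have "fps_nth (log_struct + ?c) n = fps_nth log_struct n * (1 + (q powi (2 * \<epsilon>)) ^ n)"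
        using assms(3) by (auto simp: contraction_diff_nth[OF assms(1,2)] algebra_simps)
      also have "\<dots> = - ((q1 q d powi int n + q3 q d powi int n) / of_nat n) * ?t ^ n"
        unfolding t[symmetric] using D False
        by (simp add: log_struct_def struct_coeff_def)
      also have "\<dots> = fps_nth (fps_log_one_minus (q1 q d * ?t) + fps_log_one_minus (q3 q d * ?t)) n"
        using False by (simp add: fps_log_one_minus_def power_mult_distrib field_simps)
      finally show ?thesis .
    qed (simp add: log_struct_def contraction_def fps_log_one_minus_def)
  qed
  have "struct_fun q d * fps_exp_of ?c = fps_exp_of (log_struct + ?c)"
    unfolding struct_fun_eq by (subst fps_exp_of_add) (simp_all add: log_struct_def contraction_def)
  also have "\<dots> = fps_exp_of (fps_log_one_minus (q1 q d * ?t)) * fps_exp_of (fps_log_one_minus (q3 q d * ?t))"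
    unfolding * by (rule fps_exp_of_add) (simp_all add: fps_log_one_minus_def)
  finally show ?thesis by (simp add: fps_exp_of_log_one_minus)
qed

section \<open>The anticommutator\<close>

lemma Lam_Lam:
  assumes q: "q \<noteq> 0" and ij: "i \<in> {1, 2}" "j \<in> {1, 2}" and sgn: "\<epsilon> \<in> {1, - 1}" "\<eta> \<in> {1, - 1}"
    and v: "h i 0 v = scale (of_int N) v"
  defines "\<sigma> \<equiv> pairing i j"
  shows "Lam l1 \<epsilon> i m (Lam l1 \<eta> j n v) = scale (q powi (- N - \<sigma> * N - \<sigma> * \<eta>))
    (nexp i (vcoeff \<epsilon>) (m - \<epsilon> * N - \<epsilon> * \<sigma> * \<eta>) (nexp j (vcoeff \<eta>) (n - \<eta> * \<sigma> * N) (zero_modes l1 \<epsilon> i \<eta> j v)))"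
proof -
  define u where "u = eQ_power \<eta> j (q1_power l1 \<eta> v)"
  have "h i 0 (q1_power l1 \<eta> v) = scale (of_int N) (q1_power l1 \<eta> v)"
    using v by (simp add: lin_scale[OF lin_q1_power] flip: q1_power_h[OF ij(1)])
  hence "h i 0 u = scale (of_int (N + \<sigma> * \<eta>)) u"
    by (simp add: u_def h0_eQ_power[OF ij sgn(2)] lin_scale[OF lin_eQ_power[OF ij(2)]] \<sigma>_def
      flip: scale_left_distrib)
  hence w: "h i 0 (nexp j c k u) = scale (of_int (N + \<sigma> * \<eta>)) (nexp j c k u)" for c k
    by (simp add: nexp_h0[OF ij(2,1)] lin_scale[OF lin_nexp[OF ij(2)]])
  have "Lam l1 \<eta> j n v = scale (q powi (- (\<sigma> * N))) (nexp j (vcoeff \<eta>) (n - \<eta> * (\<sigma> * N)) u)"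
    unfolding u_def \<sigma>_def by (rule Lam_eigenvector[OF ij(2) sgn(2) pairing_eigenvector[OF ij v]])
  hence "Lam l1 \<epsilon> i m (Lam l1 \<eta> j n v) = scale (q powi (- (\<sigma> * N)) * q powi (- (N + \<sigma> * \<eta>)))
    (nexp i (vcoeff \<epsilon>) (m - \<epsilon> * (N + \<sigma> * \<eta>)) (eQ_power \<epsilon> i (q1_power l1 \<epsilon> (nexp j (vcoeff \<eta>) (n - \<eta> * (\<sigma> * N)) u))))"
    using Lam_eigenvector[OF ij(1) sgn(1) w, of l1 m] by (simp add: lin_scale[OF lin_Lam[OF ij(1)]])
  also have "q powi (- (\<sigma> * N)) * q powi (- (N + \<sigma> * \<eta>)) = q powi (- N - \<sigma> * N - \<sigma> * \<eta>)"
    using q by (simp add: algebra_simps flip: power_int_add)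
  also have "eQ_power \<epsilon> i (q1_power l1 \<epsilon> (nexp j (vcoeff \<eta>) (n - \<eta> * (\<sigma> * N)) u))
    = nexp j (vcoeff \<eta>) (n - \<eta> * \<sigma> * N) (zero_modes l1 \<epsilon> i \<eta> j v)"
    by (simp only: nexp_q1_power nexp_eQ_power ij sgn zero_modes_def u_def mult.assoc)
  also have "m - \<epsilon> * (N + \<sigma> * \<eta>) = m - \<epsilon> * N - \<epsilon> * \<sigma> * \<eta>"
    by (simp add: algebra_simps)
  finally show ?thesis .
qed

lemma Lam_same_sign:
  assumes q: "q \<noteq> 0" and i: "i \<in> {1, 2}" and \<epsilon>: "\<epsilon> \<in> {1, - 1}" and v: "h i 0 v = scale (of_int N) v"
  shows "Lam l1 \<epsilon> i m (Lam l1 \<epsilon> i n v) + Lam l1 \<epsilon> i n (Lam l1 \<epsilon> i m v) = 0"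
proof -
  have g: "fps_exp_of (contraction i (vcoeff \<epsilon>) i (vcoeff \<epsilon>)) = 1 - fps_const 1 * fps_X"
    using fps_exp_of_log_one_minus[of 1] \<epsilon> by (auto simp: contraction_same[OF q])
  let ?u = "zero_modes l1 \<epsilon> i \<epsilon> i v"
  have \<epsilon>2: "\<epsilon> * \<epsilon> = 1" using \<epsilon> by auto
  have "Lam l1 \<epsilon> i m (Lam l1 \<epsilon> i n v) = scale (q powi (- N - N - \<epsilon>))
    (nprod i (vcoeff \<epsilon>) i (vcoeff \<epsilon>) (m - \<epsilon> * N - 1) (n - \<epsilon> * N) ?u
     - nprod i (vcoeff \<epsilon>) i (vcoeff \<epsilon>) (m - \<epsilon> * N) (n - \<epsilon> * N - 1) ?u)" for m n
    using Lam_Lam[OF q i i \<epsilon> \<epsilon> v, of l1 m n]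
    by (simp only: nexp_nexp[OF i i] g Sum_any_fps_linear) (simp add: pairing_def \<epsilon>2)
  thus ?thesis
    using nprod_swap[OF i i] by (simp add: scale_right_diff_distrib)
qed

text \<open>
  With \<open>x = q\<^sub>2\<close>, the scalar factors of the two orders are the expansions of \<open>q / (z - x w)\<close> and of
  \<open>- q / (z - x w)\<close> in opposite directions. Their coefficients are the two halves of one geometric series in \<open>x\<close>, so the sum of
  both products evaluates the normally ordered product at \<open>z = x w\<close>, where it is the identity.
\<close>

lemma Lam_opposite_sign:
  assumes q: "q \<noteq> 0" and i: "i \<in> {1, 2}" and v: "h i 0 v = scale (of_int N) v"
  shows "Lam l1 1 i m (Lam l1 (- 1) i n v) + Lam l1 (- 1) i n (Lam l1 1 i m v)
    = scale (if m + n + 1 = 0 then q powi (2 * n + 1) else 0) v"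
proof -
  let ?P = "nprod i (vcoeff 1) i (vcoeff (- 1))" and ?x = "q powi 2"
  let ?F = "\<lambda>b. scale (?x powi (m + n + 1 - b)) (?P (m + n + 1 - b) b v)"
  have pw: "q powi a * (q powi b) powi k = q powi (a + b * k)" for a b k
    using q by (simp add: power_int_add power_int_mult)
  have g1: "fps_nth (fps_exp_of (contraction i (vcoeff 1) i (vcoeff (- 1)))) r = (q powi 2) ^ r" for r
    by (simp add: contraction_same[OF q] fps_exp_of_minus_log_one_minus flip: fps_const_neg)
  have g2: "fps_nth (fps_exp_of (contraction i (vcoeff (- 1)) i (vcoeff 1))) r = (q powi (- 2)) ^ r" for r
    by (simp add: contraction_same[OF q] fps_exp_of_minus_log_one_minus flip: fps_const_neg)
  have fin: "finite {r. ?P (a + r) (b - r) v \<noteq> 0}" for a b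
    by (rule finite_nprod_antidiagonal[OF i i])
  have fin1: "finite {r::nat. ?P (a + int r) (b - int r) v \<noteq> 0}" for a b
    using finite_vimageI[OF fin[of a b], of int] by (simp add: vimage_def)
  have fin2: "finite {r::nat. ?P (a - int r) (b + int r) v \<noteq> 0}" for a b
    using finite_vimageI[OF fin[of a b], of "\<lambda>r. - int r"] by (simp add: vimage_def inj_def)
  \<comment> \<open>Both products are the same multiple of one half of the sum of \<open>?F\<close>, cut at \<open>b = n + N\<close>.\<close>
  have "Lam l1 1 i m (Lam l1 (- 1) i n v)
    = scale (q powi (1 - 2 * N)) (\<Sum>r. scale ((q powi 2) ^ r) (?P (m - N + 1 + int r) (n + N - int r) v))"
    using Lam_Lam[OF q i i _ _ v, of 1 "- 1" l1 m n]
    by (simp add: nexp_nexp[OF i i] g1 pairing_def zero_modes_opposite[OF i] algebra_simps)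
  also have "\<dots> = (\<Sum>r. scale (q powi (1 - 2 * N)) (scale ((q powi 2) ^ r) (?P (m - N + 1 + int r) (n + N - int r) v)))"
    by (rule scale_Sum_any, rule finite_subset[OF _ fin1[of "m - N + 1" "n + N"]]) auto
  also have "\<dots> = (\<Sum>r. scale (q powi (- 1 - 2 * m)) (?F (n + N - int r)))"
    unfolding scale_scale power_int_of_nat[symmetric] pw
    by (intro Sum_any.cong arg_cong2[where f = scale] arg_cong[where f = "\<lambda>k. q powi k"])
      (simp_all add: algebra_simps)
  finally have 1: "Lam l1 1 i m (Lam l1 (- 1) i n v) = (\<Sum>r. scale (q powi (- 1 - 2 * m)) (?F (n + N - int r)))" .
  have "Lam l1 (- 1) i n (Lam l1 1 i m v)
    = scale (q powi (- (2 * N) - 1)) (\<Sum>r. scale ((q powi (- 2)) ^ r) (?P (m - N - int r) (n + N + 1 + int r) v))"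
    using Lam_Lam[OF q i i _ _ v, of "- 1" 1 l1 n m]
      zero_modes_swap[OF i i, of "- 1" 1 l1 v] nprod_swap[OF i i, of "vcoeff (- 1)" "vcoeff 1"]
    by (simp add: nexp_nexp[OF i i] g2 pairing_def zero_modes_opposite[OF i] algebra_simps)
  also have "\<dots> = (\<Sum>r. scale (q powi (- (2 * N) - 1)) (scale ((q powi (- 2)) ^ r) (?P (m - N - int r) (n + N + 1 + int r) v)))"
    by (rule scale_Sum_any, rule finite_subset[OF _ fin2[of "m - N" "n + N + 1"]]) auto
  also have "\<dots> = (\<Sum>r. scale (q powi (- 1 - 2 * m)) (?F (n + N + 1 + int r)))"
    unfolding scale_scale power_int_of_nat[symmetric] pw
    by (intro Sum_any.cong arg_cong2[where f = scale] arg_cong[where f = "\<lambda>k. q powi k"])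
      (simp_all add: algebra_simps)
  finally have 2: "Lam l1 (- 1) i n (Lam l1 1 i m v) = (\<Sum>r. scale (q powi (- 1 - 2 * m)) (?F (n + N + 1 + int r)))" .
  have finF: "finite {b. ?F b \<noteq> 0}"
  proof (rule finite_subset)
    show "{b. ?F b \<noteq> 0} \<subseteq> uminus -` {r. ?P (m + n + 1 + r) (0 - r) v \<noteq> 0}" by auto
  qed (intro finite_vimageI fin, simp)
  have "Lam l1 1 i m (Lam l1 (- 1) i n v) + Lam l1 (- 1) i n (Lam l1 1 i m v)
    = (\<Sum>b. scale (q powi (- 1 - 2 * m)) (?F b))"
    unfolding 1 2 by (rule Sum_any_int_split[symmetric]) (rule finite_subset[OF _ finF], auto)
  also have "\<dots> = scale (q powi (- 1 - 2 * m)) (\<Sum>b. ?F b)"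
    by (rule scale_Sum_any[OF finF, symmetric])
  also have "(\<Sum>b. ?F b) = (if m + n + 1 = 0 then v else 0)"
  proof (rule nprod_cancel[OF i])
    fix k :: int
    have A: "vcoeff (- 1) k = q powi (- k) / of_int k" and B: "vcoeff 1 k = - (q powi k / of_int k)"
      by (simp_all add: vcoeff_def)
    have "q powi k * ?x powi (- k) = q powi (- k)" unfolding pw by simp
    thus "vcoeff (- 1) k = - (vcoeff 1 k * ?x powi (- k))"
      unfolding A B by (simp only: mult_minus_left minus_minus times_divide_eq_left)
  qed (use q in simp)
  also have "scale (q powi (- 1 - 2 * m)) (if m + n + 1 = 0 then v else 0)
      = scale (if m + n + 1 = 0 then q powi (2 * n + 1) else 0) v"
  proof (cases "m + n + 1 = 0")
    case True
    hence e: "- 1 - 2 * m = 2 * n + 1" by simp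
    show ?thesis unfolding e using True by simp
  qed simp
  finally show ?thesis .
qed

lemma W_current_eq: "W_current scale q l1 h a0 eQ i n v = Lam l1 1 i n v + Lam l1 (- 1) i n v"
  by (simp add: W_current_def Lam_def)

lemma lin_W_current: "i \<in> {1, 2} \<Longrightarrow> lin (W_current scale q l1 h a0 eQ i n)"
  unfolding W_current_eq[abs_def] by (intro lin_plus lin_Lam)

lemma W_anticommutator:
  fixes l1 :: complex
  assumes q: "q \<noteq> 0" and i: "i \<in> {1, 2}"
  defines "W \<equiv> W_current scale q l1 h a0 eQ i"
  shows "W m (W n v) + W n (W m v)
    = scale (if m + n + 1 = 0 then q powi (2 * n + 1) + q powi (- 2 * n - 1) else 0) v"
proof (rule lin_eq_on_span[where F = "\<lambda>v. W m (W n v) + W n (W m v)" and G = "scale _", OF _ _ diag_h0'(1)[OF i]])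
  show "lin (\<lambda>v. W m (W n v) + W n (W m v))"
    unfolding W_def
    using lin_plus[OF lin_comp[OF lin_W_current lin_W_current] lin_comp[OF lin_W_current lin_W_current]] i by blast
  fix v assume "v \<in> {v. \<exists>n. h i 0 v = scale (of_int n) v}"
  then obtain N where v: "h i 0 v = scale (of_int N) v" by blast
  have "W m (W n v) + W n (W m v)
    = (Lam l1 1 i m (Lam l1 1 i n v) + Lam l1 1 i n (Lam l1 1 i m v))
    + (Lam l1 (- 1) i m (Lam l1 (- 1) i n v) + Lam l1 (- 1) i n (Lam l1 (- 1) i m v))
    + (Lam l1 1 i m (Lam l1 (- 1) i n v) + Lam l1 (- 1) i n (Lam l1 1 i m v))
    + (Lam l1 1 i n (Lam l1 (- 1) i m v) + Lam l1 (- 1) i m (Lam l1 1 i n v))"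
    unfolding W_def W_current_eq lin_add[OF lin_Lam[OF i]] by (simp only: ac_simps)
  also have "\<dots> = scale (if m + n + 1 = 0 then q powi (2 * n + 1) else 0) v
      + scale (if n + m + 1 = 0 then q powi (2 * m + 1) else 0) v"
    by (simp only: Lam_same_sign[OF q i _ v] Lam_opposite_sign[OF q i v] add_0 insert_iff simp_thms)
  also have "\<dots> = scale (if m + n + 1 = 0 then q powi (2 * n + 1) + q powi (- 2 * n - 1) else 0) v"
  proof (cases "m + n + 1 = 0")
    case True
    hence e: "2 * m + 1 = - 2 * n - 1" by simp
    show ?thesis unfolding e using True by (simp add: scale_left_distrib add.commute[of n m])
  qed (simp add: add.commute[of n m])
  finally show "W m (W n v) + W n (W m v)
    = scale (if m + n + 1 = 0 then q powi (2 * n + 1) + q powi (- 2 * n - 1) else 0) v" .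
qed (rule lin_scale_op)

section \<open>The exchange relation\<close>

text \<open>The contribution of \<open>\<Lambda>\<^sup>\<epsilon>\<^sub>i\<close> and \<open>\<Lambda>\<^sup>\<eta>\<^sub>j\<close> to the coefficient of \<open>z\<^sup>m w\<^sup>n\<close> in \<open>f(w / z) z W\<^sub>i(z) W\<^sub>j(w)\<close>.\<close>

definition Lam_cross :: "complex \<Rightarrow> int \<Rightarrow> nat \<Rightarrow> int \<Rightarrow> nat \<Rightarrow> int \<Rightarrow> int \<Rightarrow> 'v \<Rightarrow> 'v" where
  "Lam_cross l1 \<epsilon> i \<eta> j m n v
    = (\<Sum>k. scale (fps_nth (struct_fun q d) k) (Lam l1 \<epsilon> i (m - 1 + int k) (Lam l1 \<eta> j (n - int k) v)))"

lemma Lam_cross_eigenvector: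
  assumes q: "q \<noteq> 0" and ij: "i \<in> {1, 2}" "j \<in> {1, 2}" "i \<noteq> j" and sgn: "\<epsilon> \<in> {1, - 1}" "\<eta> \<in> {1, - 1}"
    and v: "h i 0 v = scale (of_int N) v"
  shows "Lam_cross l1 \<epsilon> i \<eta> j m n v = scale (q powi \<eta>)
    (\<Sum>R. scale (fps_nth (struct_fun q d * fps_exp_of (contraction i (vcoeff \<epsilon>) j (vcoeff \<eta>))) R)
      (nprod i (vcoeff \<epsilon>) j (vcoeff \<eta>) (m - 1 - \<epsilon> * N + \<epsilon> * \<eta> + int R) (n + \<eta> * N - int R) (zero_modes l1 \<epsilon> i \<eta> j v)))"
proof -
  let ?f = "fps_nth (struct_fun q d)" and ?g = "fps_nth (fps_exp_of (contraction i (vcoeff \<epsilon>) j (vcoeff \<eta>)))"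
  let ?G = "\<lambda>R. nprod i (vcoeff \<epsilon>) j (vcoeff \<eta>) (m - 1 - \<epsilon> * N + \<epsilon> * \<eta> + int R) (n + \<eta> * N - int R) (zero_modes l1 \<epsilon> i \<eta> j v)"
  have fin: "finite {R. ?G R \<noteq> 0}"
    using finite_vimageI[OF finite_nprod_antidiagonal[OF ij(1,2)], of int] by (simp add: vimage_def)
  have "Lam l1 \<epsilon> i (m - 1 + int k) (Lam l1 \<eta> j (n - int k) v)
      = scale (q powi \<eta>) (\<Sum>r. scale (?g r) (?G (k + r)))" for k
    using Lam_Lam[OF q ij(1,2) sgn v, of l1 "m - 1 + int k" "n - int k"] ij(3)
    by (simp add: nexp_nexp[OF ij(1,2)] pairing_def algebra_simps)
  hence "Lam_cross l1 \<epsilon> i \<eta> j m n v = (\<Sum>k. scale (q powi \<eta>) (scale (?f k) (\<Sum>r. scale (?g r) (?G (k + r)))))"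
    by (simp add: Lam_cross_def mult.commute)
  also have "\<dots> = scale (q powi \<eta>) (\<Sum>k. scale (?f k) (\<Sum>r. scale (?g r) (?G (k + r))))"
  proof (rule scale_Sum_any[symmetric])
    obtain B where "\<forall>R\<in>{R. ?G R \<noteq> 0}. R \<le> B"
      using finite_nat_set_iff_bounded_le fin by blast
    hence G: "?G R = 0" if "R > B" for R using that by fastforce
    have zero: "scale (?f k) (\<Sum>r. scale (?g r) (?G (k + r))) = 0" if "k > B" for k
      using G[OF trans_less_add1[OF that]] by simp
    have "{k. scale (?f k) (\<Sum>r. scale (?g r) (?G (k + r))) \<noteq> 0} \<subseteq> {..B}"
      by (rule subsetI, rule ccontr) (simp only: mem_Collect_eq atMost_iff not_le zero simp_thms)
    thus "finite {k. scale (?f k) (\<Sum>r. scale (?g r) (?G (k + r))) \<noteq> 0}"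
      by (rule finite_subset) simp
  qed
  also have "(\<Sum>k. scale (?f k) (\<Sum>r. scale (?g r) (?G (k + r))))
      = (\<Sum>R. scale (fps_nth (struct_fun q d * fps_exp_of (contraction i (vcoeff \<epsilon>) j (vcoeff \<eta>))) R) (?G R))"
    by (rule Sum_any_fps_mult[OF fin])
  finally show ?thesis .
qed

lemma Lam_cross_same_sign:
  assumes q: "q \<noteq> 0" and ij: "i \<in> {1, 2}" "j \<in> {1, 2}" "i \<noteq> j" and \<epsilon>: "\<epsilon> \<in> {1, - 1}"
    and v: "h i 0 v = scale (of_int N) v"
  shows "Lam_cross l1 \<epsilon> i \<epsilon> j m n v = Lam_cross l1 \<epsilon> j \<epsilon> i n m v"
proof -
  have v': "h j 0 v = scale (of_int (- N)) v"
    using pairing_eigenvector[OF ij(1,2) v] ij(3) by (simp add: pairing_def)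
  have \<epsilon>2: "\<epsilon> * \<epsilon> = 1" using \<epsilon> by auto
  show ?thesis
    unfolding Lam_cross_eigenvector[OF q ij \<epsilon> \<epsilon> v] Lam_cross_eigenvector[OF q ij(2,1) ij(3)[symmetric] \<epsilon> \<epsilon> v']
      struct_contraction_same_sign[OF q ij(3) \<epsilon>] struct_contraction_same_sign[OF q ij(3)[symmetric] \<epsilon>]
      Sum_any_fps_one zero_modes_swap[OF ij(2,1) \<epsilon> \<epsilon>] nprod_swap[OF ij(2,1)]
    by (simp add: \<epsilon>2)
qed

text \<open>
  The two sides are \<open>q\<^sup>-\<^sup>1 (z - q\<^sub>1 q\<^sub>2 w) (z - q\<^sub>3 q\<^sub>2 w)\<close> and
  \<open>q (w - q\<^sub>1 z) (w - q\<^sub>3 z)\<close> times the same operators, and these polynomials agree because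
  \<open>q\<^sub>1 q\<^sub>3 = q\<^sup>-\<^sup>2\<close> and \<open>q\<^sub>2 = q\<^sup>2\<close>.
\<close>

lemma Lam_cross_opposite_sign:
  assumes q: "q \<noteq> 0" and d: "d \<noteq> 0" and ij: "i \<in> {1, 2}" "j \<in> {1, 2}" "i \<noteq> j"
    and generic: "\<And>n. n > 0 \<Longrightarrow> 1 + q2 q powi (- int n) \<noteq> 0"
    and v: "h i 0 v = scale (of_int N) v"
  shows "Lam_cross l1 1 i (- 1) j m n v = Lam_cross l1 (- 1) j 1 i n m v"
proof -
  have v': "h j 0 v = scale (of_int (- N)) v"
    using pairing_eigenvector[OF ij(1,2) v] ij(3) by (simp add: pairing_def)
  have s: "1 \<in> {1, - 1 :: int}" "- 1 \<in> {1, - 1 :: int}" by simp_all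
  let ?P = "\<lambda>k. nprod i (vcoeff 1) j (vcoeff (- 1)) (m - N - 2 + k) (n - N - k) (zero_modes l1 1 i (- 1) j v)"
  let ?a = "q1 q d" and ?b = "q3 q d"
  have "Lam_cross l1 1 i (- 1) j m n v = scale (q powi (- 1))
      (?P 0 - scale (?a * q powi 2 + ?b * q powi 2) (?P 1) + scale (?a * q powi 2 * (?b * q powi 2)) (?P 2))"
    unfolding Lam_cross_eigenvector[OF q ij s v] struct_contraction_opposite_sign[OF q ij(3) s(1) generic, simplified]
    by (subst Sum_any_fps_quadratic) (simp add: algebra_simps)
  moreover have "Lam_cross l1 (- 1) j 1 i n m v = scale q (?P 2 - scale (?a + ?b) (?P 1) + scale (?a * ?b) (?P 0))"
    unfolding Lam_cross_eigenvector[OF q ij(2,1) ij(3)[symmetric] s(2,1) v']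
      struct_contraction_opposite_sign[OF q ij(3)[symmetric] s(2) generic, simplified]
      zero_modes_swap[OF ij(2,1) s(2,1)] nprod_swap[OF ij(2,1)]
    by (subst Sum_any_fps_quadratic) (simp add: algebra_simps)
  moreover have "q powi (- 1) * (?a * q powi 2 + ?b * q powi 2) = q * (?a + ?b)"
    "q powi (- 1) * (?a * q powi 2 * (?b * q powi 2)) = q" "q * (?a * ?b) = q powi (- 1)"
    using q d by (simp_all add: q1_def q3_def field_simps power2_eq_square)
  ultimately show ?thesis
    by (simp only: scale_right_distrib scale_right_diff_distrib scale_scale) simp
qed

lemma finite_Lam_Lam:
  assumes ij: "i \<in> {1, 2}" "j \<in> {1, 2}" and \<eta>: "\<eta> \<in> {1, - 1}" and v: "h j 0 v = scale (of_int N) v"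
  shows "finite {k. scale (f k) (Lam l1 \<epsilon> i (g k) (Lam l1 \<eta> j (n - int k) v)) \<noteq> 0}"
proof -
  obtain M where M: "nexp j (vcoeff \<eta>) k (eQ_power \<eta> j (q1_power l1 \<eta> v)) = 0" if "k < M" for k
    using normal_exp_finite(2)[OF ij(2)] by blast
  have "Lam l1 \<eta> j (n - int k) v = 0" if "k > nat (n - \<eta> * N - M)" for k
    unfolding Lam_eigenvector[OF ij(2) \<eta> v] by (subst M) (use that in auto)
  hence "{k. scale (f k) (Lam l1 \<epsilon> i (g k) (Lam l1 \<eta> j (n - int k) v)) \<noteq> 0} \<subseteq> {..nat (n - \<eta> * N - M)}"
    using lin_0[OF lin_Lam[OF ij(1)]] by (auto intro!: leI)
  thus ?thesis by (rule finite_subset) simp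
qed

text \<open>
  The coefficient of \<open>z\<^sup>m w\<^sup>n\<close> in \<open>f(w / z) z W\<^sub>i(z) W\<^sub>j(w)\<close>. The other side of the exchange relation has the same form
  with \<open>i\<close>, \<open>j\<close> and \<open>z\<close>, \<open>w\<close> exchanged.
\<close>

definition twisted_product :: "complex \<Rightarrow> nat \<Rightarrow> nat \<Rightarrow> int \<Rightarrow> int \<Rightarrow> 'v \<Rightarrow> 'v" where
  "twisted_product l1 i j m n v = (\<Sum>k. scale (fps_nth (struct_fun q d) k)
    (W_current scale q l1 h a0 eQ i (m - 1 + int k) (W_current scale q l1 h a0 eQ j (n - int k) v)))"

lemma twisted_product_eq:
  assumes ij: "i \<in> {1, 2}" "j \<in> {1, 2}" and v: "h j 0 v = scale (of_int N) v"
  shows "twisted_product l1 i j m n v = Lam_cross l1 1 i 1 j m n v + Lam_cross l1 1 i (- 1) j m n v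
    + Lam_cross l1 (- 1) i 1 j m n v + Lam_cross l1 (- 1) i (- 1) j m n v"
proof -
  let ?t = "\<lambda>\<epsilon> \<eta> k. scale (fps_nth (struct_fun q d) k) (Lam l1 \<epsilon> i (m - 1 + int k) (Lam l1 \<eta> j (n - int k) v))"
  have fin: "finite {k. ?t \<epsilon> 1 k \<noteq> 0}" "finite {k. ?t \<epsilon> (- 1) k \<noteq> 0}" for \<epsilon>
    by (rule finite_Lam_Lam[OF ij _ v], simp)+
  have fin2: "finite {k. ?t \<epsilon> 1 k + ?t \<epsilon> (- 1) k \<noteq> 0}" for \<epsilon>
    by (rule finite_subset[OF _ finite_UnI[OF fin(1)[of \<epsilon>] fin(2)[of \<epsilon>]]]) auto
  have "twisted_product l1 i j m n v = (\<Sum>k. (?t 1 1 k + ?t 1 (- 1) k) + (?t (- 1) 1 k + ?t (- 1) (- 1) k))"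
    unfolding twisted_product_def W_current_eq lin_add[OF lin_Lam[OF ij(1)]] scale_right_distrib
    by (intro Sum_any.cong) (simp only: ac_simps)
  also have "\<dots> = (Lam_cross l1 1 i 1 j m n v + Lam_cross l1 1 i (- 1) j m n v)
    + (Lam_cross l1 (- 1) i 1 j m n v + Lam_cross l1 (- 1) i (- 1) j m n v)"
    unfolding Sum_any.distrib[OF fin2 fin2] Sum_any.distrib[OF fin] Lam_cross_def ..
  finally show ?thesis by (simp only: add.assoc)
qed

lemma lin_twisted_product:
  assumes "i \<in> {1, 2}" "j \<in> {1, 2}"
  shows "lin (twisted_product l1 i j m n)"
  unfolding twisted_product_def[abs_def]
proof (rule lin_Sum_anyI)
  show "finite {k. scale (fps_nth (struct_fun q d) k)
    (W_current scale q l1 h a0 eQ i (m - 1 + int k) (W_current scale q l1 h a0 eQ j (n - int k) v)) \<noteq> 0}" for v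
    using relation_sums_finite(1)[OF assms, of "struct_fun q d" l1 m n v]
    by (simp add: mult_z_power_def prod_zw_def algebra_simps)
qed (intro lin_comp[OF lin_scale_op] lin_comp[OF lin_W_current[OF assms(1)] lin_W_current[OF assms(2)]])

lemma twisted_product_swap:
  assumes q: "q \<noteq> 0" and d: "d \<noteq> 0" and ij: "i \<in> {1, 2}" "j \<in> {1, 2}" "i \<noteq> j"
    and generic: "\<And>n. n > 0 \<Longrightarrow> 1 + q2 q powi (- int n) \<noteq> 0"
  shows "twisted_product l1 i j m n v = twisted_product l1 j i n m v"
proof (rule lin_eq_on_span[OF lin_twisted_product[OF ij(1,2)] lin_twisted_product[OF ij(2,1)] diag_h0'(1)[OF ij(1)]])
  fix v assume "v \<in> {v. \<exists>n. h i 0 v = scale (of_int n) v}"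
  then obtain N where v: "h i 0 v = scale (of_int N) v" by blast
  have v': "h j 0 v = scale (of_int (- N)) v"
    using pairing_eigenvector[OF ij(1,2) v] ij(3) by (simp add: pairing_def)
  have same: "Lam_cross l1 \<epsilon> i \<epsilon> j m n v = Lam_cross l1 \<epsilon> j \<epsilon> i n m v" if "\<epsilon> \<in> {1, - 1}" for \<epsilon>
    by (rule Lam_cross_same_sign[OF q ij that v])
  have opposite: "Lam_cross l1 1 i (- 1) j m n v = Lam_cross l1 (- 1) j 1 i n m v"
    by (rule Lam_cross_opposite_sign[OF q d ij _ v]) (rule generic)
  have opposite': "Lam_cross l1 1 j (- 1) i n m v = Lam_cross l1 (- 1) i 1 j m n v"
    by (rule Lam_cross_opposite_sign[OF q d ij(2,1) ij(3)[symmetric] _ v']) (rule generic)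
  show "twisted_product l1 i j m n v = twisted_product l1 j i n m v"
    unfolding twisted_product_eq[OF ij(1,2) v'] twisted_product_eq[OF ij(2,1) v] opposite opposite'
    by (simp add: same ac_simps)
qed

end

theorem proposition5p1:
  fixes q d l1 l3 :: complex
    and scale :: "complex \<Rightarrow> 'v \<Rightarrow> 'v::ab_group_add"
    and h :: "nat \<Rightarrow> int \<Rightarrow> 'v \<Rightarrow> 'v"
    and a0 :: "'v \<Rightarrow> 'v"
    and eQ :: "nat \<Rightarrow> 'v \<Rightarrow> 'v"
    and eQ0 :: "'v \<Rightarrow> 'v"
  assumes "q \<noteq> 0" and "d \<noteq> 0"
    and "\<And>n m :: int. (n, m) \<noteq> (0, 0) \<Longrightarrow> q powi n * d powi m \<noteq> 1"
    and "exp l1 = q1 q d" and "exp l3 = q3 q d"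
    and "heisenberg_module scale q d (- l3 / l1) h a0 eQ eQ0"
  defines "W \<equiv> W_current scale q l1 h a0 eQ"
  shows "(\<forall>i\<in>{1, 2}. \<forall>m n v.
            prod_zw (W i) (W i) m n v + prod_wz (W i) (W i) m n v =
            scale (q * mult_z_power (- 1) (delta_wz (q2 q)) m n
                   + inverse q * mult_z_power (- 1) (delta_wz (inverse (q2 q))) m n) v) \<and>
         (\<forall>i\<in>{1, 2}. \<forall>j\<in>{1, 2}. i \<noteq> j \<longrightarrow> (\<forall>m n v.
            mult_fps_wz scale (struct_fun q d) (mult_z_power 1 (prod_zw (W i) (W j))) m n v
            - mult_fps_zw scale (struct_fun q d) (mult_w_power 1 (prod_wz (W j) (W i))) m n v = 0))"
proof -
  interpret heisenberg_module scale q d "- l3 / l1" h a0 eQ eQ0 by fact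
  \<comment> \<open>The denominators in \<open>f\<close> are nonzero since \<open>q\<close> is not a root of unity.\<close>
  have generic: "1 + q2 q powi (- int n) \<noteq> 0" if "n > 0" for n
  proof
    assume "1 + q2 q powi (- int n) = 0"
    moreover have "q2 q powi (- int n) = q powi (- 2 * int n)"
      using power_int_mult[of q 2 "- int n"] by (simp add: q2_def)
    ultimately have "q powi (- 2 * int n) = - 1"
      by (simp only: eq_neg_iff_add_eq_0 add.commute)
    hence "q powi (- 2 * int n) * q powi (- 2 * int n) = 1" by simp
    hence "q powi (- 4 * int n) = 1" using \<open>q \<noteq> 0\<close> by (simp flip: power_int_add)
    thus False using assms(3)[of "- 4 * int n" 0] that by simp
  qed
  have anti: "prod_zw (W i) (W i) m n v + prod_wz (W i) (W i) m n v =
      scale (q * mult_z_power (- 1) (delta_wz (q2 q)) m n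
        + inverse q * mult_z_power (- 1) (delta_wz (inverse (q2 q))) m n) v" if i: "i \<in> {1, 2}" for i m n v
  proof -
    have "q2 q powi n = q powi (2 * n)"
      using power_int_mult[of q 2 n] by (simp add: q2_def)
    hence "q * q2 q powi n = q powi (2 * n + 1)" "inverse q * inverse (q2 q) powi n = q powi (- 2 * n - 1)"
      using \<open>q \<noteq> 0\<close>
      by (simp_all add: power_int_add power_int_diff power_int_minus power_int_inverse field_simps)
    moreover have "m + 1 = - n \<longleftrightarrow> m + n + 1 = 0" by auto
    ultimately have "q * mult_z_power (- 1) (delta_wz (q2 q)) m n
        + inverse q * mult_z_power (- 1) (delta_wz (inverse (q2 q))) m n
      = (if m + n + 1 = 0 then q powi (2 * n + 1) + q powi (- 2 * n - 1) else 0)"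
      by (simp add: mult_z_power_def delta_wz_def)
    thus ?thesis
      using W_anticommutator[OF \<open>q \<noteq> 0\<close> i, of l1 m n v] by (simp add: prod_zw_def prod_wz_def W_def)
  qed
  have comm: "mult_fps_wz scale (struct_fun q d) (mult_z_power 1 (prod_zw (W i) (W j))) m n v
      = mult_fps_zw scale (struct_fun q d) (mult_w_power 1 (prod_wz (W j) (W i))) m n v"
    if ij: "i \<in> {1, 2}" "j \<in> {1, 2}" "i \<noteq> j" for i j m n v
    using twisted_product_swap[OF \<open>q \<noteq> 0\<close> \<open>d \<noteq> 0\<close> ij generic, of l1 m n v]
    by (simp add: twisted_product_def mult_fps_wz_def mult_fps_zw_def mult_z_power_def mult_w_power_def
      prod_zw_def prod_wz_def W_def algebra_simps)
  show ?thesis using anti comm by simp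
qed

end
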